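(* Let $X=\{X_t\}_{t\in[0,T]}$ belong to the class $\mathcal X^{(H,\beta)}$ with $H<\frac12$, and let $y_t=X_t+\int_0^t a_s\,\mathrm ds$, $t\in[0,T]$. Assume that the process $a$ is almost surely bounded. Then there exist positive constants $C_1$ and $C_2$ such that for any $\epsilon\in(0,1)$ and for any interval $[0,T]$, we have $$\mathbb P(\|y\|_\infty\le\epsilon)\le C_1\exp\left(-C_2T\epsilon^{-\frac{2H-2\beta+1}{\beta}}\right).$$ The constants are independent of $\epsilon$ and $T$.
   Context: $\|f\|_\infty=\sup_{t\in[0,T]}|f_t|$. The process $a=\{a_t\}_{t\in[0,T]}$ is a stochastic process, possibly dependent on $X$, such that the Lebesgue integral $\int_0^t a_s\,\mathrm ds$ is well defined. Class $\mathcal X^{(H,\beta)}$, for $H\in(0,1)$ and $\beta\in[H,1)$: a centered Gaussian process $X=\{X_t\}_{t\in[0,T]}$ with $X_0=0$ belongs to this class if (1) the incremental variance function $\sigma^2(s,t)=\mathbb E[(X_t-X_s)^2]$ is $C^1$ for $s\ne t$ and satisfies $|\partial_s\partial_t\sigma^2(s,t)|\le c|t-s|^{2H-2}$; (2) $c|t-s|^{2\beta}\le\sigma^2(s,t)\le C|t-s|^{2H}$. Here $c$ and $C$ denote generic positive constants, where $c$ need not be the same in (1) and (2). *)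

theory Defs
  imports "HOL-Probability.Probability"
begin

(* Degenerate (a.s. constant) variables count as Gaussian; the library's normal_density
   only covers positive standard deviation. *)
definition gaussian_rv :: "'w measure \<Rightarrow> ('w \<Rightarrow> real) \<Rightarrow> bool" where
  "gaussian_rv M Z \<longleftrightarrow> Z \<in> borel_measurable M \<and>
     (\<exists>\<mu>. (AE w in M. Z w = \<mu>) \<or> (\<exists>s>0. distributed M lborel Z (normal_density \<mu> s)))"

definition centered_gaussian_process ::
    "'w measure \<Rightarrow> real set \<Rightarrow> (real \<Rightarrow> 'w \<Rightarrow> real) \<Rightarrow> bool" where
  "centered_gaussian_process M I X \<longleftrightarrow>
     (\<forall>F b. finite F \<and> F \<subseteq> I \<longrightarrow> gaussian_rv M (\<lambda>w. \<Sum>t\<in>F. b t * X t w)) \<and>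
     (\<forall>t\<in>I. X t \<in> borel_measurable M \<and> integral\<^sup>L M (X t) = 0)"

definition incr_var :: "'w measure \<Rightarrow> (real \<Rightarrow> 'w \<Rightarrow> real) \<Rightarrow> real \<Rightarrow> real \<Rightarrow> real" where
  "incr_var M X s t = integral\<^sup>L M (\<lambda>w. (X t w - X s w)\<^sup>2)"

(* f is C^1 on [0,T]^2 off the diagonal (both partial derivatives f1, f2 exist and are jointly
   continuous there; derivatives at the end points 0 and T are one-sided), and the mixed
   derivative f12 = d/ds (d/dt f), whose existence does not follow from C^1, exists there and is
   bounded by c * |t - s|^(2H - 2). *)
definition C1_mixed_bound :: "real \<Rightarrow> real \<Rightarrow> real \<Rightarrow> (real \<Rightarrow> real \<Rightarrow> real) \<Rightarrow> bool" where
  "C1_mixed_bound T H c f \<longleftrightarrow>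
     (\<exists>f1 f2 f12.
        continuous_on {(s, t). s \<in> {0..T} \<and> t \<in> {0..T} \<and> s \<noteq> t} (\<lambda>(s, t). f1 s t) \<and>
        continuous_on {(s, t). s \<in> {0..T} \<and> t \<in> {0..T} \<and> s \<noteq> t} (\<lambda>(s, t). f2 s t) \<and>
        (\<forall>s\<in>{0..T}. \<forall>t\<in>{0..T}. s \<noteq> t \<longrightarrow>
           ((\<lambda>u. f u t) has_real_derivative f1 s t) (at s within {0..T}) \<and>
           ((\<lambda>u. f s u) has_real_derivative f2 s t) (at t within {0..T}) \<and>
           ((\<lambda>u. f2 u t) has_real_derivative f12 s t) (at s within {0..T}) \<and>
           \<bar>f12 s t\<bar> \<le> c * \<bar>t - s\<bar> powr (2 * H - 2)))"

(* Membership of X = (X_t), t in [0,T], in the class with parameters (H, \<beta>), with the positive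
   constants made explicit: c1 is the constant in the bound on the mixed derivative, c2 and C
   those in the lower and upper bounds on the variance. Exposing them is what lets a statement
   say that other constants do not depend on T. *)
definition class_X ::
    "real \<Rightarrow> real \<Rightarrow> real \<Rightarrow> real \<Rightarrow> real \<Rightarrow> 'w measure \<Rightarrow> real \<Rightarrow> (real \<Rightarrow> 'w \<Rightarrow> real) \<Rightarrow> bool" where
  "class_X H \<beta> c1 c2 C M T X \<longleftrightarrow>
     centered_gaussian_process M {0..T} X \<and>
     (AE w in M. X 0 w = 0) \<and>
     C1_mixed_bound T H c1 (incr_var M X) \<and>
     (\<forall>s\<in>{0..T}. \<forall>t\<in>{0..T}.
        c2 * \<bar>t - s\<bar> powr (2 * \<beta>) \<le> incr_var M X s t \<and>
        incr_var M X s t \<le> C * \<bar>t - s\<bar> powr (2 * H))"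

(* The integral over [0,t] is well defined for all t in [0,T] iff it is for t = T. No relation
   between a and X, and no adaptedness of a, is required. *)
definition drift_process :: "'w measure \<Rightarrow> real \<Rightarrow> (real \<Rightarrow> 'w \<Rightarrow> real) \<Rightarrow> bool" where
  "drift_process M T a \<longleftrightarrow>
     (\<forall>t\<in>{0..T}. a t \<in> borel_measurable M) \<and>
     (AE w in M. set_integrable lebesgue {0..T} (\<lambda>s. a s w))"

(* Bounded by a deterministic constant K outside a null set. *)
definition as_bounded_by :: "'w measure \<Rightarrow> real \<Rightarrow> real \<Rightarrow> (real \<Rightarrow> 'w \<Rightarrow> real) \<Rightarrow> bool" where
  "as_bounded_by M T K a \<longleftrightarrow> (AE w in M. \<forall>t\<in>{0..T}. \<bar>a t w\<bar> \<le> K)"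

definition with_drift ::
    "(real \<Rightarrow> 'w \<Rightarrow> real) \<Rightarrow> (real \<Rightarrow> 'w \<Rightarrow> real) \<Rightarrow> real \<Rightarrow> 'w \<Rightarrow> real" where
  "with_drift X a t w = X t w + (LINT s:{0..t}|lebesgue. a s w)"

(* Extended-real valued, so that an unbounded path has norm \<infinity> (a real-valued
   supremum would be unspecified there). *)
definition sup_norm :: "real \<Rightarrow> (real \<Rightarrow> real) \<Rightarrow> ereal" where
  "sup_norm T f = (SUP t\<in>{0..T}. ereal \<bar>f t\<bar>)"

(* P(A) as outer probability: it is the probability of A whenever A is an event, and it is
   meaningful also when A is not, whereas measure M A would then be 0. A supremum over
   uncountably many t, of paths with no assumed regularity, need not be measurable. *)
definition outer_prob :: "'w measure \<Rightarrow> 'w set \<Rightarrow> ennreal" where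
  "outer_prob M A = outer_measure_of M A"

lemma outer_prob_event:
  assumes "prob_space M" "A \<in> sets M"
  shows "outer_prob M A = ennreal (measure M A)"
proof -
  interpret prob_space M by fact
  show ?thesis
    using assms(2) by (simp add: outer_prob_def emeasure_eq_measure)
qed

end

theory Submission
  imports Defs
begin

text \<open>
  Put \<open>\<delta> = \<epsilon> powr (1 / \<beta>)\<close> and \<open>\<tau> = 2 * m * \<delta> powr (1 - 2 * (\<beta> - H))\<close> with a large constant \<open>m\<close>. If
  \<open>\<bar>y\<bar> \<le> \<epsilon>\<close> on \<open>[0, T]\<close>, then the increments of \<open>X\<close> over the intervals \<open>[i * \<tau>, i * \<tau> + \<delta>]\<close> are at most
  \<open>2 * \<epsilon> + \<bar>K\<bar> * \<delta> \<le> (2 + \<bar>K\<bar>) * \<epsilon>\<close>, while their variances are at least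
  \<open>c2 * \<delta> powr (2 * \<beta>) = c2 * \<epsilon>\<^sup>2\<close>. By the bound on the mixed derivative and since \<open>2 * H - 2 < - 1\<close>,
  the rows of their covariance matrix have off-diagonal absolute sums at most half of the diagonal
  entry, so the matrix is \<open>\<kappa> * Id\<close> plus a diagonally dominant one, with \<open>\<kappa>\<close> of order \<open>\<epsilon>\<^sup>2\<close>. Such a
  Gaussian vector of length \<open>n\<close> stays in a cube of half-width of order \<open>\<epsilon>\<close> with probability at
  most \<open>p ^ n\<close>, \<open>p < 1\<close>, and \<open>n\<close> is \<open>T / \<tau>\<close> rounded down.

  The estimate for Gaussian vectors only uses the characteristic functions of linear combinations:
  the indicator of the cube is dominated, up to a constant factor per coordinate, by a product of
  trigonometric polynomials \<open>1 - sin (\<omega> * x) ^ (2 * k)\<close>, whose expectation is a finite sum.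
\<close>

section \<open>Characteristic functions of centered Gaussian variables\<close>

lemma integral_iexp_std_normal:
  "(CLINT h|std_normal_distribution. iexp (c * h)) = exp (- of_real (c\<^sup>2 / 2))"
proof -
  have "(CLINT h|std_normal_distribution. iexp (c * h)) = char std_normal_distribution c"
    by (simp add: char_def)
  then show ?thesis
    by (simp add: char_std_normal_distribution exp_of_real[symmetric])
qed

text \<open>In the degenerate case the zero mean forces the constant to be 0; otherwise division by
  the standard deviation reduces everything to the standard normal law. Both cases end in one
  formula, so later arguments need not separate them.\<close>

lemma (in prob_space) centered_gaussian_rv:
  assumes "gaussian_rv M Z" and mean: "expectation Z = 0"
  shows "integrable M Z"
    and "integrable M (\<lambda>w. (Z w)\<^sup>2)"
    and "(CLINT w|M. iexp (Z w)) = exp (- of_real (expectation (\<lambda>w. (Z w)\<^sup>2) / 2))"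
proof -
  have Z[measurable]: "Z \<in> borel_measurable M"
    using assms(1) by (simp add: gaussian_rv_def)
  have "integrable M Z \<and> integrable M (\<lambda>w. (Z w)\<^sup>2) \<and>
    (CLINT w|M. iexp (Z w)) = exp (- of_real (expectation (\<lambda>w. (Z w)\<^sup>2) / 2))"
  proof (cases "\<exists>\<mu>. AE w in M. Z w = \<mu>")
    case True
    then obtain \<mu> where \<mu>: "AE w in M. Z w = \<mu>" by blast
    have "expectation Z = expectation (\<lambda>w. \<mu>)"
      by (rule integral_cong_AE) (use \<mu> in auto)
    then have "\<mu> = 0" using mean by (simp add: prob_space)
    with \<mu> have ae: "AE w in M. Z w = 0" by simp
    have 1: "integrable M Z"
      by (subst integrable_cong_AE[where g = "\<lambda>_. 0"]) (use ae in auto)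
    have 2: "integrable M (\<lambda>w. (Z w)\<^sup>2)"
      by (subst integrable_cong_AE[where g = "\<lambda>_. 0"]) (use ae in auto)
    have 3: "expectation (\<lambda>w. (Z w)\<^sup>2) = 0"
      by (subst integral_cong_AE[where g = "\<lambda>_. 0"]) (use ae in auto)
    have 4: "(CLINT w|M. iexp (Z w)) = (CLINT w|M. 1)"
      by (rule integral_cong_AE) (use ae in auto)
    show ?thesis using 1 2 3 4 by (simp add: prob_space)
  next
    case False
    then obtain \<mu> s where s: "s > 0" and D: "distributed M lborel Z (normal_density \<mu> s)"
      using assms(1) by (auto simp: gaussian_rv_def)
    have "\<mu> = 0" using normal_distributed_expectation[OF s D] mean by simp
    with D have D0: "distributed M lborel Z (normal_density 0 s)" by simp
    have int1: "integrable M Z"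
      using distributed_integrable[OF D0, of "\<lambda>x. x"] integrable_normal_moment[OF s, of 0 1] by simp
    have int2: "integrable M (\<lambda>w. (Z w)\<^sup>2)"
      using distributed_integrable[OF D0, of "\<lambda>x. x\<^sup>2"] integrable_normal_moment[OF s, of 0 2] by simp
    have var: "expectation (\<lambda>w. (Z w)\<^sup>2) = s\<^sup>2"
      using normal_distributed_variance[OF s D0] mean by simp
    have Y: "distributed M lborel (\<lambda>w. Z w / s) std_normal_density"
      using normal_standard_normal_convert[OF s, of Z 0] D0 by simp
    have dist: "distr M lborel (\<lambda>w. Z w / s) = std_normal_distribution"
      using distributed_distr_eq_density[OF Y] by simp
    have "(CLINT w|M. iexp (Z w)) = (CLINT w|M. iexp (s * (Z w / s)))"
      using s by simp
    also have "\<dots> = (CLINT y|distr M lborel (\<lambda>w. Z w / s). iexp (s * y))"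
      by (subst integral_distr) auto
    also have "\<dots> = exp (- of_real (s\<^sup>2 / 2))"
      unfolding dist by (rule integral_iexp_std_normal)
    finally show ?thesis using int1 int2 var by simp
  qed
  then show "integrable M Z" "integrable M (\<lambda>w. (Z w)\<^sup>2)"
    "(CLINT w|M. iexp (Z w)) = exp (- of_real (expectation (\<lambda>w. (Z w)\<^sup>2) / 2))"
    by blast+
qed

section \<open>Trigonometric sums under a diagonally dominant Gaussian covariance\<close>

lemma norm_integral_average_le:
  fixes F :: "'b \<Rightarrow> complex"
  assumes "prob_space N" "integrable N F" "\<And>h. norm (F h) \<le> b"
  shows "norm (integral\<^sup>L N F) \<le> b"
proof -
  interpret prob_space N by fact
  have "norm (integral\<^sup>L N F) \<le> (\<integral>h. norm (F h) \<partial>N)"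
    by (rule integral_norm_bound)
  also have "\<dots> \<le> (\<integral>h. b \<partial>N)"
    by (rule integral_mono) (use assms in auto)
  finally show ?thesis by (simp add: prob_space)
qed

text \<open>Each factor \<open>exp (-(\<Sum>i. v e i * u i)\<^sup>2 / 2)\<close> is an average over a standard normal \<open>h\<close>
  of \<open>iexp (h * (\<Sum>i. v e i * u i))\<close>, that is, of shifts of \<open>z\<close>; a bound that is uniform in \<open>z\<close>
  therefore survives it.\<close>
lemma trig_sum_gaussian_damping:
  fixes A :: "'j \<Rightarrow> complex" and u :: "'j \<Rightarrow> 'i \<Rightarrow> real" and v :: "'e \<Rightarrow> 'i \<Rightarrow> real"
  assumes "finite E" and "finite I"
    and "\<And>z. norm (\<Sum>J\<in>\<J>. A J * iexp (\<Sum>i\<in>I. u J i * z i)) \<le> b"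
  shows "norm (\<Sum>J\<in>\<J>. A J * iexp (\<Sum>i\<in>I. u J i * z i)
           * of_real (\<Prod>e\<in>E. exp (- (\<Sum>i\<in>I. u J i * v e i)\<^sup>2 / 2))) \<le> b"
  using assms(1)
\<comment> \<open>The point \<open>z\<close> is generalised because averaging over \<open>h\<close>
  calls the induction hypothesis at all points \<open>z i + h * v e i\<close>.\<close>
proof (induction E arbitrary: z rule: finite_induct)
  case empty
  then show ?case using assms(3) by simp
next
  case (insert e E)
  define P where "P J = (\<Prod>e\<in>E. exp (- (\<Sum>i\<in>I. u J i * v e i)\<^sup>2 / 2))" for J
  define F where "F h = (\<Sum>J\<in>\<J>. A J * iexp (\<Sum>i\<in>I. u J i * (z i + h * v e i)) * of_real (P J))" for h
  interpret N: real_distribution std_normal_distribution by (rule real_dist_normal_dist)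
  have int: "complex_integrable std_normal_distribution (\<lambda>h. iexp (c * h))" for c
    by (rule N.integrable_const_bound[where B = 1]) auto
  have F: "F h = (\<Sum>J\<in>\<J>. (A J * iexp (\<Sum>i\<in>I. u J i * z i) * of_real (P J))
      * iexp ((\<Sum>i\<in>I. u J i * v e i) * h))" for h
    unfolding F_def
    by (intro sum.cong refl)
      (simp add: algebra_simps sum.distrib sum_distrib_left sum_distrib_right exp_add)
  have "integral\<^sup>L std_normal_distribution F =
      (\<Sum>J\<in>\<J>. (A J * iexp (\<Sum>i\<in>I. u J i * z i) * of_real (P J))
        * exp (- of_real ((\<Sum>i\<in>I. u J i * v e i)\<^sup>2 / 2)))"
    unfolding F using int by (subst Bochner_Integration.integral_sum) (simp_all add: integral_iexp_std_normal del: of_real_sum of_real_mult)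
  also have "\<dots> = (\<Sum>J\<in>\<J>. A J * iexp (\<Sum>i\<in>I. u J i * z i)
           * of_real (\<Prod>e\<in>insert e E. exp (- (\<Sum>i\<in>I. u J i * v e i)\<^sup>2 / 2)))"
    using insert.hyps by (intro sum.cong refl) (simp add: P_def exp_of_real[symmetric])
  finally have eq: "integral\<^sup>L std_normal_distribution F = \<dots>" .
  have "integrable std_normal_distribution F"
    unfolding F using int by (intro Bochner_Integration.integrable_sum integrable_mult_right)
  moreover have "norm (F h) \<le> b" for h
    unfolding F_def P_def using insert.IH[of "\<lambda>i. z i + h * v e i"] .
  ultimately show ?case
    using norm_integral_average_le[OF N.prob_space_axioms] eq by metis
qed

text \<open>Completing the square in \<open>u i * u j * \<Sigma> i j\<close> costs
  \<open>\<bar>\<Sigma> i j\<bar> / 2\<close> times \<open>(u i)\<^sup>2 + (u j)\<^sup>2\<close>.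
  Over all ordered pairs the cost at \<open>u i\<close> is the off-diagonal row sum, which the
  diagonal entry pays for, with \<open>\<kappa>\<close> to spare.\<close>

lemma diag_dominant_sum_squares:
  fixes \<Sigma> :: "'i \<Rightarrow> 'i \<Rightarrow> real"
  assumes "finite I"
    and sym: "\<And>i j. i \<in> I \<Longrightarrow> j \<in> I \<Longrightarrow> \<Sigma> i j = \<Sigma> j i"
    and dom: "\<And>i. i \<in> I \<Longrightarrow> \<kappa> + (\<Sum>j\<in>I - {i}. \<bar>\<Sigma> i j\<bar>) \<le> \<Sigma> i i"
  shows "\<exists>v :: 'i \<times> 'i \<Rightarrow> 'i \<Rightarrow> real. \<forall>u. (\<Sum>i\<in>I. \<Sum>j\<in>I. u i * u j * \<Sigma> i j)
    = \<kappa> * (\<Sum>i\<in>I. (u i)\<^sup>2) + (\<Sum>e\<in>I \<times> I. (\<Sum>l\<in>I. u l * v e l)\<^sup>2)"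
proof -
  define B where "B i j = (if i = j then 0 else \<bar>\<Sigma> i j\<bar>)" for i j
  define r where "r i = \<Sigma> i i - \<kappa> - (\<Sum>j\<in>I. B i j)" for i
  \<comment> \<open>The index \<open>(i, i)\<close> carries what is left of the diagonal entry,
    \<open>r i\<close>; the indices \<open>(i, j)\<close> and \<open>(j, i)\<close> share the square
    of one unordered pair, hence the division by 2. The sign makes the cross term equal to
    \<open>\<Sigma> i j\<close>.\<close>
  define v where "v e l = (case e of (i, j) \<Rightarrow>
    if i = j then sqrt (r i) * of_bool (l = i)
    else sqrt (\<bar>\<Sigma> i j\<bar> / 2) * (of_bool (l = i) + sgn (\<Sigma> i j) * of_bool (l = j)))" for e l
  have B_sum: "(\<Sum>j\<in>I. B i j) = (\<Sum>j\<in>I - {i}. \<bar>\<Sigma> i j\<bar>)" if "i \<in> I" for i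
  proof -
    have "(\<Sum>j\<in>I. B i j) = (\<Sum>j\<in>I - {i}. B i j)"
      using assms(1) by (intro sum.mono_neutral_right) (auto simp: B_def)
    also have "\<dots> = (\<Sum>j\<in>I - {i}. \<bar>\<Sigma> i j\<bar>)"
      by (intro sum.cong) (auto simp: B_def)
    finally show ?thesis .
  qed
  have r: "r i \<ge> 0" if "i \<in> I" for i
    using dom[OF that] that by (simp add: r_def B_sum)
  have square: "(\<Sum>l\<in>I. u l * v (i, j) l)\<^sup>2 = u i * u j * \<Sigma> i j
      + (if i = j then - (\<kappa> + (\<Sum>k\<in>I. B i k)) * (u i)\<^sup>2 else 0)
      + B i j / 2 * (u i)\<^sup>2 + B i j / 2 * (u j)\<^sup>2" if "i \<in> I" "j \<in> I" for u i j
  proof (cases "i = j")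
    case True
    have "(\<Sum>l\<in>I. u l * v (i, j) l) = (\<Sum>l\<in>I. if l = i then sqrt (r i) * u i else 0)"
      using True by (intro sum.cong) (auto simp: v_def)
    then have "(\<Sum>l\<in>I. u l * v (i, j) l) = sqrt (r i) * u i"
      using that assms(1) by simp
    then show ?thesis using r[OF that(1)] True
      by (simp add: power_mult_distrib r_def B_def power2_eq_square algebra_simps)
  next
    case False
    have "(\<Sum>l\<in>I. u l * v (i, j) l)
        = sqrt (\<bar>\<Sigma> i j\<bar> / 2) * (\<Sum>l\<in>I. (if l = i then u i else 0) + (if l = j then sgn (\<Sigma> i j) * u j else 0))"
      using False unfolding sum_distrib_left by (intro sum.cong) (auto simp: v_def)
    also have "(\<Sum>l\<in>I. (if l = i then u i else 0) + (if l = j then sgn (\<Sigma> i j) * u j else 0))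
        = u i + sgn (\<Sigma> i j) * u j"
      using that assms(1) by (simp add: sum.distrib)
    finally have "(\<Sum>l\<in>I. u l * v (i, j) l)\<^sup>2 = \<bar>\<Sigma> i j\<bar> / 2 * (u i + sgn (\<Sigma> i j) * u j)\<^sup>2"
      by (simp add: power_mult_distrib)
    also have "\<dots> = u i * u j * \<Sigma> i j + \<bar>\<Sigma> i j\<bar> / 2 * (u i)\<^sup>2 + \<bar>\<Sigma> i j\<bar> / 2 * (u j)\<^sup>2"
      by (cases "\<Sigma> i j" "0::real" rule: linorder_cases)
        (auto simp: power2_eq_square algebra_simps)
    finally show ?thesis using False by (simp add: B_def)
  qed
  have "(\<Sum>i\<in>I. \<Sum>j\<in>I. u i * u j * \<Sigma> i j)
    = \<kappa> * (\<Sum>i\<in>I. (u i)\<^sup>2) + (\<Sum>e\<in>I \<times> I. (\<Sum>l\<in>I. u l * v e l)\<^sup>2)" for u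
  proof -
    have "(\<Sum>e\<in>I \<times> I. (\<Sum>l\<in>I. u l * v e l)\<^sup>2) = (\<Sum>i\<in>I. \<Sum>j\<in>I. (\<Sum>l\<in>I. u l * v (i, j) l)\<^sup>2)"
      by (simp add: sum.cartesian_product)
    also have "\<dots> = (\<Sum>i\<in>I. \<Sum>j\<in>I. u i * u j * \<Sigma> i j
      + (if i = j then - (\<kappa> + (\<Sum>k\<in>I. B i k)) * (u i)\<^sup>2 else 0)
      + B i j / 2 * (u i)\<^sup>2 + B i j / 2 * (u j)\<^sup>2)"
      by (intro sum.cong refl square)
    also have "\<dots> = (\<Sum>i\<in>I. \<Sum>j\<in>I. u i * u j * \<Sigma> i j)
      + (\<Sum>i\<in>I. - (\<kappa> + (\<Sum>k\<in>I. B i k)) * (u i)\<^sup>2)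
      + (\<Sum>i\<in>I. \<Sum>j\<in>I. B i j / 2 * (u i)\<^sup>2) + (\<Sum>i\<in>I. \<Sum>j\<in>I. B i j / 2 * (u j)\<^sup>2)"
      using assms(1) by (simp add: sum.distrib)
    \<comment> \<open>Symmetry turns column sums into row sums, so that the two halves together
      cancel the row sum subtracted in \<open>r\<close>.\<close>
    also have "(\<Sum>i\<in>I. \<Sum>j\<in>I. B i j / 2 * (u j)\<^sup>2) = (\<Sum>i\<in>I. \<Sum>j\<in>I. B i j / 2 * (u i)\<^sup>2)"
      by (subst sum.swap, intro sum.cong refl) (auto simp: B_def sym)
    also have "(\<Sum>i\<in>I. - (\<kappa> + (\<Sum>k\<in>I. B i k)) * (u i)\<^sup>2)
      = - \<kappa> * (\<Sum>i\<in>I. (u i)\<^sup>2) - 2 * (\<Sum>i\<in>I. \<Sum>j\<in>I. B i j / 2 * (u i)\<^sup>2)"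
      by (simp add: sum_distrib_left sum_distrib_right sum_subtractf sum_negf algebra_simps sum.distrib)
    finally show ?thesis by simp
  qed
  then show ?thesis by blast
qed

text \<open>Expanding the product gives exponentials of linear forms in the \<open>\<xi> i\<close>,
  whose expectations \<open>char\<close> supplies. Each quadratic form splits by
  \<open>diag_dominant_sum_squares\<close>: the part with \<open>\<kappa>\<close> is that of
  independent coordinates and factorises into the means bounded by \<open>p\<close>, while the
  remaining squares only damp, by \<open>trig_sum_gaussian_damping\<close>. That lemma needs a bound
  at every \<open>z\<close>, hence the uniformity of \<open>p\<close>.\<close>

lemma (in prob_space) gaussian_vector_prod_trig_le:
  fixes \<xi> :: "'i \<Rightarrow> 'a \<Rightarrow> real" and \<Sigma> :: "'i \<Rightarrow> 'i \<Rightarrow> real" and f :: "real \<Rightarrow> real"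
  assumes I: "finite I" and S: "finite S" and \<kappa>: "0 \<le> \<kappa>"
    and meas[measurable]: "\<And>i. i \<in> I \<Longrightarrow> \<xi> i \<in> borel_measurable M"
    and char: "\<And>c. (CLINT w|M. iexp (\<Sum>i\<in>I. c i * \<xi> i w))
      = exp (- of_real ((\<Sum>i\<in>I. \<Sum>j\<in>I. c i * c j * \<Sigma> i j) / 2))"
    and sym: "\<And>i j. i \<in> I \<Longrightarrow> j \<in> I \<Longrightarrow> \<Sigma> i j = \<Sigma> j i"
    and dom: "\<And>i. i \<in> I \<Longrightarrow> \<kappa> + (\<Sum>j\<in>I - {i}. \<bar>\<Sigma> i j\<bar>) \<le> \<Sigma> i i"
    and f: "\<And>x. complex_of_real (f x) = (\<Sum>j\<in>S. a j * iexp (l j * x))"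
    and p: "\<And>z. \<bar>LINT g|std_normal_distribution. f (sqrt \<kappa> * g + z)\<bar> \<le> p"
  shows "\<bar>expectation (\<lambda>w. \<Prod>i\<in>I. f (\<xi> i w))\<bar> \<le> p ^ card I"
proof -
  interpret N: real_distribution std_normal_distribution by (rule real_dist_normal_dist)
  define \<J> where "\<J> = PiE I (\<lambda>_. S)"
  obtain v :: "'i \<times> 'i \<Rightarrow> 'i \<Rightarrow> real"
    where v: "\<And>u. (\<Sum>i\<in>I. \<Sum>j\<in>I. u i * u j * \<Sigma> i j)
      = \<kappa> * (\<Sum>i\<in>I. (u i)\<^sup>2) + (\<Sum>e\<in>I \<times> I. (\<Sum>l\<in>I. u l * v e l)\<^sup>2)"
    using diag_dominant_sum_squares[of I \<Sigma> \<kappa>] I sym dom by blast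
  \<comment> \<open>The part of the Gaussian factor that belongs to independent coordinates is put
    into the coefficients; only the damping squares stay outside.\<close>
  define A where "A J = (\<Prod>i\<in>I. a (J i) * exp (- of_real (\<kappa> * (l (J i))\<^sup>2 / 2)))" for J
  have int: "integrable M (\<lambda>w. iexp (\<Sum>i\<in>I. c i * \<xi> i w))" for c
    by (rule integrable_const_bound[where B = 1]) auto
  have "complex_of_real (expectation (\<lambda>w. \<Prod>i\<in>I. f (\<xi> i w)))
      = (CLINT w|M. (\<Prod>i\<in>I. \<Sum>j\<in>S. a j * iexp (l j * \<xi> i w)))"
    unfolding f[symmetric] integral_complex_of_real[symmetric] by simp
  also have "\<dots> = (CLINT w|M. (\<Sum>J\<in>\<J>. (\<Prod>i\<in>I. a (J i)) * iexp (\<Sum>i\<in>I. l (J i) * \<xi> i w)))"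
    unfolding \<J>_def using I S
    by (simp add: prod_sum_PiE prod.distrib exp_sum sum_distrib_left)
  also have "\<dots> = (\<Sum>J\<in>\<J>. (\<Prod>i\<in>I. a (J i))
      * exp (- of_real ((\<Sum>i\<in>I. \<Sum>j\<in>I. l (J i) * l (J j) * \<Sigma> i j) / 2)))"
    using int[of "\<lambda>i. l (J i)" for J] char[of "\<lambda>i. l (J i)" for J]
    by (subst Bochner_Integration.integral_sum) (simp_all del: of_real_sum of_real_mult)
  \<comment> \<open>The phase \<open>l (J i) * 0\<close> is the value at \<open>z = 0\<close>, kept
    so that the sum has the shape of the damping lemma.\<close>
  also have "\<dots> = (\<Sum>J\<in>\<J>. A J * iexp (\<Sum>i\<in>I. l (J i) * 0)
      * of_real (\<Prod>e\<in>I \<times> I. exp (- (\<Sum>i\<in>I. l (J i) * v e i)\<^sup>2 / 2)))"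
  proof (intro sum.cong refl)
    fix J
    have "exp (- complex_of_real ((\<Sum>i\<in>I. \<Sum>j\<in>I. l (J i) * l (J j) * \<Sigma> i j) / 2))
      = of_real (exp (- (\<Sum>i\<in>I. \<kappa> * (l (J i))\<^sup>2 / 2) - (\<Sum>e\<in>I \<times> I. (\<Sum>i\<in>I. l (J i) * v e i)\<^sup>2 / 2)))"
      unfolding v[of "\<lambda>i. l (J i)"] exp_of_real[symmetric]
      by (simp add: sum_distrib_left sum_divide_distrib add_divide_distrib)
    also have "exp (- (\<Sum>i\<in>I. \<kappa> * (l (J i))\<^sup>2 / 2) - (\<Sum>e\<in>I \<times> I. (\<Sum>i\<in>I. l (J i) * v e i)\<^sup>2 / 2))
      = (\<Prod>i\<in>I. exp (- (\<kappa> * (l (J i))\<^sup>2 / 2))) * (\<Prod>e\<in>I \<times> I. exp (- (\<Sum>i\<in>I. l (J i) * v e i)\<^sup>2 / 2))"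
      using I by (simp add: exp_sum[symmetric] exp_add[symmetric] sum_negf)
    finally show "(\<Prod>i\<in>I. a (J i))
      * exp (- of_real ((\<Sum>i\<in>I. \<Sum>j\<in>I. l (J i) * l (J j) * \<Sigma> i j) / 2)) =
      A J * iexp (\<Sum>i\<in>I. l (J i) * 0)
      * of_real (\<Prod>e\<in>I \<times> I. exp (- (\<Sum>i\<in>I. l (J i) * v e i)\<^sup>2 / 2))"
      by (simp add: A_def prod.distrib exp_of_real[symmetric])
  qed
  finally have eq: "complex_of_real (expectation (\<lambda>w. \<Prod>i\<in>I. f (\<xi> i w))) = \<dots>" .
  \<comment> \<open>Without damping the sum factorises over the coordinates, for every
    \<open>z\<close>, into one-dimensional Gaussian means of \<open>f\<close>.\<close>
  have base: "norm (\<Sum>J\<in>\<J>. A J * iexp (\<Sum>i\<in>I. l (J i) * z i)) \<le> p ^ card I" for z :: "'i \<Rightarrow> real"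
  proof -
    have one: "complex_of_real (LINT g|std_normal_distribution. f (sqrt \<kappa> * g + y))
      = (\<Sum>j\<in>S. a j * exp (- of_real (\<kappa> * (l j)\<^sup>2 / 2)) * iexp (l j * y))" for y
    proof -
      have intN: "complex_integrable std_normal_distribution (\<lambda>g. iexp (c * g))" for c
        by (rule N.integrable_const_bound[where B = 1]) auto
      have "complex_of_real (LINT g|std_normal_distribution. f (sqrt \<kappa> * g + y))
        = (CLINT g|std_normal_distribution. (\<Sum>j\<in>S. (a j * iexp (l j * y)) * iexp ((l j * sqrt \<kappa>) * g)))"
        unfolding integral_complex_of_real[symmetric] f
        by (intro Bochner_Integration.integral_cong refl sum.cong) (simp add: algebra_simps exp_add)
      also have "\<dots> = (\<Sum>j\<in>S. (a j * iexp (l j * y)) * exp (- of_real ((l j * sqrt \<kappa>)\<^sup>2 / 2)))"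
        using intN by (subst Bochner_Integration.integral_sum)
          (simp_all add: integral_iexp_std_normal del: of_real_mult)
      also have "\<dots> = (\<Sum>j\<in>S. a j * exp (- of_real (\<kappa> * (l j)\<^sup>2 / 2)) * iexp (l j * y))"
        using \<kappa> by (intro sum.cong refl) (simp add: power_mult_distrib mult_ac of_real_power[symmetric] del: of_real_power)
      finally show ?thesis .
    qed
    have "(\<Sum>J\<in>\<J>. A J * iexp (\<Sum>i\<in>I. l (J i) * z i))
      = (\<Prod>i\<in>I. complex_of_real (LINT g|std_normal_distribution. f (sqrt \<kappa> * g + z i)))"
      unfolding one \<J>_def A_def using I S
      by (simp add: prod_sum_PiE prod.distrib exp_sum sum_distrib_left)
    also have "norm \<dots> \<le> p ^ card I"
      unfolding prod_norm[symmetric] using p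
      by (subst prod_constant[symmetric], intro prod_mono) auto
    finally show ?thesis .
  qed
  have "norm (complex_of_real (expectation (\<lambda>w. \<Prod>i\<in>I. f (\<xi> i w)))) \<le> p ^ card I"
    unfolding eq by (rule trig_sum_gaussian_damping[OF _ I base]) (use I in auto)
  then show ?thesis by simp
qed

section \<open>The test function \<open>1 - sin x ^ (2 * k)\<close> and its Gaussian mean\<close>

text \<open>Euler's formula and the binomial theorem. As the exponent is even, the frequency 0
  occurs, at \<open>j = k\<close>, and its coefficient absorbs the constant 1.\<close>

lemma one_minus_sin_power_trig_sum:
  obtains a l where
    "\<And>x. complex_of_real (1 - sin x ^ (2 * k)) = (\<Sum>j\<le>2 * k. a j * iexp (l j * x))"
proof -
  define n where "n = 2 * k"
  define l where "l j = 2 * real j - real n" for j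
  define a :: "nat \<Rightarrow> complex" where
    "a j = of_bool (j = k) - of_nat (n choose j) * (- 1) ^ (n - j) / (2 * \<i>) ^ n" for j
  have "complex_of_real (1 - sin x ^ n) = (\<Sum>j\<le>n. a j * iexp (l j * x))" for x
  proof -
    have "complex_of_real (sin x) = (iexp x + - iexp (- x)) / (2 * \<i>)"
      unfolding sin_of_real[symmetric] sin_exp_eq by simp
    then have "complex_of_real (sin x ^ n) = (iexp x + - iexp (- x)) ^ n / (2 * \<i>) ^ n"
      by (simp only: of_real_power power_divide)
    also have "\<dots> = (\<Sum>j\<le>n. of_nat (n choose j) * iexp x ^ j * (- iexp (- x)) ^ (n - j) / (2 * \<i>) ^ n)"
      by (simp only: binomial_ring sum_divide_distrib)
    also have "\<dots> = (\<Sum>j\<le>n. of_nat (n choose j) * (- 1) ^ (n - j) / (2 * \<i>) ^ n * iexp (l j * x))"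
    proof (intro sum.cong refl)
      fix j assume "j \<in> {..n}"
      then have "iexp x ^ j * iexp (- x) ^ (n - j) = iexp (l j * x)"
        by (simp add: exp_of_nat_mult[symmetric] exp_add[symmetric] l_def of_nat_diff algebra_simps)
      moreover have "(- iexp (- x)) ^ (n - j) = (- 1) ^ (n - j) * iexp (- x) ^ (n - j)"
        by (rule power_minus)
      ultimately show "of_nat (n choose j) * iexp x ^ j * (- iexp (- x)) ^ (n - j) / (2 * \<i>) ^ n
          = of_nat (n choose j) * (- 1) ^ (n - j) / (2 * \<i>) ^ n * iexp (l j * x)"
        by (simp add: mult_ac)
    qed
    moreover have "(\<Sum>j\<le>n. of_bool (j = k) * iexp (l j * x)) = 1"
      by (subst sum.remove[of _ k]) (auto simp: l_def n_def)
    ultimately show ?thesis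
      by (simp add: a_def left_diff_distrib sum_subtractf)
  qed
  then show thesis using that unfolding n_def by blast
qed

text \<open>The square of the sine is at least 1/2 on half of each period. The bounds on
  \<open>c\<close> place such an interval in a window that does not depend on \<open>z\<close>,
  where the normal density has a positive lower bound.\<close>

lemma sin_power_ge_half:
  fixes \<alpha> z :: real
  assumes "0 < \<alpha>"
  obtains c where "0 \<le> c" "c \<le> pi / \<alpha>"
    and "\<And>g. c \<le> g \<Longrightarrow> g \<le> c + pi / (2 * \<alpha>) \<Longrightarrow> (1/2) ^ k \<le> sin (\<alpha> * g + z) ^ (2 * k)"
proof
  \<comment> \<open>The least integer for which \<open>c\<close>, the point where the angle is
    \<open>pi / 4\<close> modulo \<open>pi\<close>, is nonnegative.\<close>
  define m where "m = \<lceil>(z - pi / 4) / pi\<rceil>"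
  define c where "c = (of_int m * pi + pi / 4 - z) / \<alpha>"
  have "(z - pi / 4) / pi \<le> of_int m" "of_int m \<le> (z - pi / 4) / pi + 1"
    unfolding m_def by linarith+
  then have m: "z - pi / 4 \<le> of_int m * pi" "of_int m * pi \<le> z - pi / 4 + pi"
    by (simp_all add: field_simps)
  show "0 \<le> c" using m assms by (simp add: c_def)
  show "c \<le> pi / \<alpha>" unfolding c_def using m assms by (intro divide_right_mono) auto
  show "(1/2) ^ k \<le> sin (\<alpha> * g + z) ^ (2 * k)" if "c \<le> g" "g \<le> c + pi / (2 * \<alpha>)" for g
  proof -
    define y where "y = \<alpha> * g + z - of_int m * pi"
    have "\<alpha> * c \<le> \<alpha> * g" "\<alpha> * g \<le> \<alpha> * (c + pi / (2 * \<alpha>))"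
      using that assms by (auto intro: mult_left_mono)
    moreover have "\<alpha> * c = of_int m * pi + pi / 4 - z" "\<alpha> * (c + pi / (2 * \<alpha>)) = \<alpha> * c + pi / 2"
      using assms by (simp_all add: c_def distrib_left)
    ultimately have y: "pi / 4 \<le> y" "y \<le> 3 * pi / 4"
      by (simp_all add: y_def)
    \<comment> \<open>Doubling the angle removes the shift by \<open>m\<close> half turns and
      reduces the claim to the sign of a cosine.\<close>
    have "cos (2 * (\<alpha> * g + z)) = cos (2 * y + 2 * pi * of_int m)"
      by (simp add: y_def algebra_simps)
    also have "\<dots> = cos (2 * y)"
      by (simp add: cos_add)
    also have "\<dots> = - cos (2 * y - pi)"
      by simp
    also have "\<dots> \<le> 0"
      using y cos_ge_zero[of "2 * y - pi"] by (simp only: neg_le_0_iff_le)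
    finally have "1 / 2 \<le> (sin (\<alpha> * g + z))\<^sup>2"
      using cos_double_sin[of "\<alpha> * g + z"] by linarith
    then have "(1 / 2) ^ k \<le> ((sin (\<alpha> * g + z))\<^sup>2) ^ k"
      by (intro power_mono) auto
    then show ?thesis by (simp add: power_mult)
  qed
qed

lemma sin_power_even_le_one: "sin x ^ (2 * k) \<le> (1::real)"
proof -
  have "\<bar>sin x ^ (2 * k)\<bar> \<le> 1"
    unfolding power_abs by (intro power_le_one) auto
  then show ?thesis by simp
qed

text \<open>\<open>(1/4) ^ k\<close> is the maximum of \<open>sin x ^ (2 * k)\<close> on \<open>\<bar>x\<bar> \<le> pi / 6\<close>. The Gaussian mean of that function
  is at least \<open>q * (1/2) ^ k\<close> for every shift \<open>z\<close>, which is larger once \<open>2 ^ k > 1 / q\<close>; this is why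
  the cube may be much wider than the standard deviation.\<close>
lemma std_normal_sin_power_bound:
  fixes \<alpha> :: real
  assumes "0 < \<alpha>"
  obtains k p where "0 < k" "0 < p" "p < 1"
    "\<And>z. \<bar>LINT g|std_normal_distribution. 1 - sin (\<alpha> * g + z) ^ (2 * k)\<bar> \<le> p * (1 - (1/4) ^ k)"
proof -
  interpret N: real_distribution std_normal_distribution by (rule real_dist_normal_dist)
  define L where "L = pi / (2 * \<alpha>)"
  have L: "L > 0" "pi / \<alpha> = 2 * L" using assms by (simp_all add: L_def)
  \<comment> \<open>The interval \<open>{c..c + L}\<close> lies in \<open>{0..3 * L}\<close>, where
    the density is at least its value at \<open>3 * L\<close>; this bounds its Gaussian mass from
    below. The minimum with 1 excludes \<open>k = 0\<close> and makes \<open>p\<close>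
    positive.\<close>
  define q where "q = min 1 (std_normal_density (3 * L) * L)"
  have q: "0 < q" "q \<le> 1" using L normal_density_pos[of 1 0 "3 * L"] by (simp_all add: q_def)
  obtain k where "1 / q < 2 ^ k" using real_arch_pow[of 2 "1 / q"] by auto
  then have k: "1 < q * 2 ^ k" using q by (simp add: field_simps)
  have "k \<noteq> 0"
  proof
    assume "k = 0"
    with k q show False by simp
  qed
  have pow: "(1/4::real) ^ k < q * (1/2) ^ k"
  proof -
    have "(1/4::real) ^ k = (1/2) ^ k * (1/2) ^ k" by (simp flip: power_mult_distrib)
    also have "\<dots> < (q * 2 ^ k) * ((1/2) ^ k * (1/2) ^ k)"
      using mult_strict_right_mono[OF k, of "(1/2) ^ k * (1/2) ^ k"] by simp
    also have "\<dots> = q * (1/2) ^ k" by (simp add: power_one_over)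
    finally show ?thesis .
  qed
  have "q * (1/2) ^ k \<le> 1 * (1/2) ^ 1"
    using q \<open>k \<noteq> 0\<close> by (intro mult_mono power_decreasing) auto
  then have half: "q * (1/2) ^ k \<le> 1/2" by simp
  have lower: "q * (1/2) ^ k \<le> (LINT g|std_normal_distribution. sin (\<alpha> * g + z) ^ (2 * k))" for z
  proof -
    obtain c where c: "0 \<le> c" "c \<le> 2 * L"
      "\<And>g. c \<le> g \<Longrightarrow> g \<le> c + L \<Longrightarrow> (1/2) ^ k \<le> sin (\<alpha> * g + z) ^ (2 * k)"
      using sin_power_ge_half[OF assms, of k z] L by (auto simp: L_def[symmetric])
    have "q * (1/2) ^ k \<le> (std_normal_density (3 * L) * L) * (1/2) ^ k"
      by (intro mult_right_mono) (auto simp: q_def)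
    also have "\<dots> = (LINT g|lborel. indicator {c..c + L} g *\<^sub>R (std_normal_density (3 * L) * (1/2) ^ k))"
      using L by simp
    also have "\<dots> \<le> (LINT g|lborel. std_normal_density g * sin (\<alpha> * g + z) ^ (2 * k))"
    proof (rule integral_mono)
      show "integrable lborel (\<lambda>g. indicator {c..c + L} g *\<^sub>R (std_normal_density (3 * L) * (1/2) ^ k))"
        using L by (intro integrable_scaleR_left integrable_real_indicator) simp_all
      have "integrable std_normal_distribution (\<lambda>g. sin (\<alpha> * g + z) ^ (2 * k))"
        by (rule N.integrable_const_bound[where B = 1]) (auto simp: power_abs intro!: power_le_one)
      then show "integrable lborel (\<lambda>g. std_normal_density g * sin (\<alpha> * g + z) ^ (2 * k))"
        by (subst (asm) integrable_density) auto
      fix g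
      show "indicator {c..c + L} g *\<^sub>R (std_normal_density (3 * L) * (1/2) ^ k)
        \<le> std_normal_density g * sin (\<alpha> * g + z) ^ (2 * k)"
      proof (cases "g \<in> {c..c + L}")
        case True
        then have "g\<^sup>2 \<le> (3 * L)\<^sup>2" using c(1,2) by (intro power_mono) auto
        then have "std_normal_density (3 * L) \<le> std_normal_density g"
          unfolding std_normal_density_def by (intro mult_left_mono) auto
        then show ?thesis using True c(3)[of g] by (auto intro!: mult_mono)
      qed simp
    qed
    also have "\<dots> = (LINT g|std_normal_distribution. sin (\<alpha> * g + z) ^ (2 * k))"
      by (subst integral_density) auto
    finally show ?thesis .
  qed
  \<comment> \<open>The denominator is the lower bound of the test function on the cube, so
    \<open>p\<close> is what each coordinate costs after dominating the indicator. By
    \<open>pow\<close> it is below 1.\<close>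
  define p where "p = (1 - q * (1/2) ^ k) / (1 - (1/4) ^ k)"
  have quarter: "(1/4::real) ^ k < 1" using pow half by linarith
  show thesis
  proof
    show "0 < k" using \<open>k \<noteq> 0\<close> by simp
    show "0 < p" using half quarter by (simp add: p_def)
    show "p < 1" using pow quarter by (simp add: p_def)
    fix z
    have sin_int: "integrable std_normal_distribution (\<lambda>g. sin (\<alpha> * g + z) ^ (2 * k))"
      by (rule N.integrable_const_bound[where B = 1]) (auto simp: power_abs intro!: power_le_one)
    have "(LINT g|std_normal_distribution. sin (\<alpha> * g + z) ^ (2 * k)) \<le> (LINT g|std_normal_distribution. 1)"
      using sin_int by (intro integral_mono) (auto simp: sin_power_even_le_one)
    then show "\<bar>LINT g|std_normal_distribution. 1 - sin (\<alpha> * g + z) ^ (2 * k)\<bar> \<le> p * (1 - (1/4) ^ k)"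
      using lower[of z] sin_int quarter N.prob_space by (simp add: p_def)
  qed
qed

section \<open>Small balls for Gaussian vectors in the maximum norm\<close>

text \<open>The test function \<open>f\<close> is nonnegative and at least \<open>b\<close> on
  \<open>\<bar>x\<bar> \<le> R\<close>, so \<open>b ^ card I\<close> times the indicator of the cube
  is at most the product of the \<open>f (\<xi> i w)\<close>, whose expectation is at most
  \<open>(p * b) ^ card I\<close>. The number \<open>p\<close> is fixed before the space, the vector
  and \<open>R\<close>, and depends on \<open>\<alpha>\<close> only.\<close>

lemma gaussian_vector_small_ball:
  fixes \<alpha> :: real
  assumes "0 < \<alpha>"
  obtains p where "0 < p" "p < 1"
    "\<And>(M :: 'w measure) (I :: 'i set) \<xi> \<Sigma> R.
      prob_space M \<Longrightarrow> finite I \<Longrightarrow> 0 < R \<Longrightarrow>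
      (\<And>i. i \<in> I \<Longrightarrow> \<xi> i \<in> borel_measurable M) \<Longrightarrow>
      (\<And>c. (CLINT w|M. iexp (\<Sum>i\<in>I. c i * \<xi> i w))
        = exp (- of_real ((\<Sum>i\<in>I. \<Sum>j\<in>I. c i * c j * \<Sigma> i j) / 2))) \<Longrightarrow>
      (\<And>i j. i \<in> I \<Longrightarrow> j \<in> I \<Longrightarrow> \<Sigma> i j = \<Sigma> j i) \<Longrightarrow>
      (\<And>i. i \<in> I \<Longrightarrow> (\<alpha> * R)\<^sup>2 + (\<Sum>j\<in>I - {i}. \<bar>\<Sigma> i j\<bar>) \<le> \<Sigma> i i) \<Longrightarrow>
      measure M {w \<in> space M. \<forall>i\<in>I. \<bar>\<xi> i w\<bar> \<le> R} \<le> p ^ card I"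
proof -
  \<comment> \<open>The frequency \<open>\<omega> = pi / (6 * R)\<close> maps the cube to angles up
    to \<open>pi / 6\<close>; multiplied by the standard deviation \<open>\<alpha> * R\<close> it
    gives \<open>\<alpha> * pi / 6\<close>, free of \<open>R\<close>.\<close>
  have "0 < \<alpha> * pi / 6" using assms by simp
  then obtain k p where kp: "0 < k" "0 < p" "p < 1"
    "\<And>z. \<bar>LINT g|std_normal_distribution. 1 - sin (\<alpha> * pi / 6 * g + z) ^ (2 * k)\<bar> \<le> p * (1 - (1/4) ^ k)"
    by (rule std_normal_sin_power_bound) blast
  obtain a l where al:
    "\<And>x. complex_of_real (1 - sin x ^ (2 * k)) = (\<Sum>j\<le>2 * k. a j * iexp (l j * x))"
    by (rule one_minus_sin_power_trig_sum) blast
  show thesis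
  proof (rule that[OF kp(2,3)])
    fix M :: "'w measure" and I :: "'i set" and \<xi> \<Sigma> R
    assume "prob_space M" and I: "finite I" and R: "0 < R"
      and meas[measurable]: "\<And>i. i \<in> I \<Longrightarrow> \<xi> i \<in> borel_measurable M"
      and char: "\<And>c. (CLINT w|M. iexp (\<Sum>i\<in>I. c i * \<xi> i w))
        = exp (- of_real ((\<Sum>i\<in>I. \<Sum>j\<in>I. c i * c j * \<Sigma> i j) / 2))"
      and sym: "\<And>i j. i \<in> I \<Longrightarrow> j \<in> I \<Longrightarrow> \<Sigma> i j = \<Sigma> j i"
      and dom: "\<And>i. i \<in> I \<Longrightarrow> (\<alpha> * R)\<^sup>2 + (\<Sum>j\<in>I - {i}. \<bar>\<Sigma> i j\<bar>) \<le> \<Sigma> i i"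
    interpret prob_space M by fact
    define \<omega> where "\<omega> = pi / (6 * R)"
    define f where "f x = 1 - sin (\<omega> * x) ^ (2 * k)" for x
    define b :: real where "b = 1 - (1/4) ^ k"
    have \<omega>: "\<omega> > 0" "\<omega> * (\<alpha> * R) = \<alpha> * pi / 6" using R by (simp_all add: \<omega>_def)
    have f01: "0 \<le> f x" "f x \<le> 1" for x
      by (simp_all add: f_def sin_power_even_le_one)
    have f_ge: "b \<le> f x" if "\<bar>x\<bar> \<le> R" for x
    proof -
      have "\<omega> * \<bar>x\<bar> \<le> \<omega> * R" using that \<omega> by (intro mult_left_mono) auto
      then have "\<bar>\<omega> * x\<bar> \<le> pi / 6" using R \<omega> by (simp add: abs_mult \<omega>_def)
      then have "sin \<bar>\<omega> * x\<bar> \<le> sin (pi / 6)"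
        by (intro sin_monotone_2pi_le) auto
      moreover have "0 \<le> sin \<bar>\<omega> * x\<bar>"
        using \<open>\<bar>\<omega> * x\<bar> \<le> pi / 6\<close> pi_gt_zero by (intro sin_ge_zero abs_ge_zero) linarith
      ultimately have "(sin \<bar>\<omega> * x\<bar>)\<^sup>2 \<le> (1/2)\<^sup>2"
        by (intro power_mono) (simp_all only: sin_30)
      then have "(sin (\<omega> * x))\<^sup>2 \<le> 1/4"
        by (auto simp: abs_if power2_eq_square split: if_splits)
      then have "((sin (\<omega> * x))\<^sup>2) ^ k \<le> (1/4) ^ k"
        by (intro power_mono) auto
      then show ?thesis by (simp add: f_def b_def power_mult)
    qed
    have "(1/4::real) ^ k < 1" using kp(1) by (intro power_less_one_iff[THEN iffD2]) auto
    have quarter: "0 < b" using \<open>(1/4) ^ k < 1\<close> by (simp add: b_def)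
    have sqrt: "sqrt ((\<alpha> * R)\<^sup>2) = \<alpha> * R" using assms R by simp
    have "\<bar>expectation (\<lambda>w. \<Prod>i\<in>I. f (\<xi> i w))\<bar> \<le> (p * b) ^ card I"
    proof (rule gaussian_vector_prod_trig_le[OF I _ _ meas char sym dom])
      show "complex_of_real (f x) = (\<Sum>j\<le>2 * k. a j * iexp ((l j * \<omega>) * x))" for x
        unfolding f_def al by (simp add: mult.assoc)
      show "\<bar>LINT g|std_normal_distribution. f (sqrt ((\<alpha> * R)\<^sup>2) * g + z)\<bar> \<le> p * b" for z
        using kp(4)[of "\<omega> * z"] unfolding f_def b_def sqrt \<omega>(2)[symmetric]
        by (simp add: algebra_simps)
    qed auto
    moreover have "b ^ card I * prob {w \<in> space M. \<forall>i\<in>I. \<bar>\<xi> i w\<bar> \<le> R}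
      \<le> expectation (\<lambda>w. \<Prod>i\<in>I. f (\<xi> i w))"
    proof -
      have [measurable]: "{w \<in> space M. \<forall>i\<in>I. \<bar>\<xi> i w\<bar> \<le> R} \<in> sets M"
        using I by measurable
      have f_meas[measurable]: "f \<in> borel_measurable borel"
        unfolding f_def by measurable
      have "b ^ card I * prob {w \<in> space M. \<forall>i\<in>I. \<bar>\<xi> i w\<bar> \<le> R}
        = expectation (\<lambda>w. b ^ card I * indicator {w \<in> space M. \<forall>i\<in>I. \<bar>\<xi> i w\<bar> \<le> R} w)"
        by simp
      also have "\<dots> \<le> expectation (\<lambda>w. \<Prod>i\<in>I. f (\<xi> i w))"
      proof (rule integral_mono)
        show "integrable M (\<lambda>w. b ^ card I * indicator {w \<in> space M. \<forall>i\<in>I. \<bar>\<xi> i w\<bar> \<le> R} w)"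
          by (intro integrable_mult_right integrable_real_indicator) (simp_all add: emeasure_eq_measure)
        have "\<bar>\<Prod>i\<in>I. f (\<xi> i w)\<bar> \<le> 1" for w
          unfolding abs_prod using f01 by (intro prod_le_1) auto
        then show "integrable M (\<lambda>w. \<Prod>i\<in>I. f (\<xi> i w))"
          by (intro integrable_const_bound[where B = 1]) auto
        fix w assume "w \<in> space M"
        show "b ^ card I * indicator {w \<in> space M. \<forall>i\<in>I. \<bar>\<xi> i w\<bar> \<le> R} w
          \<le> (\<Prod>i\<in>I. f (\<xi> i w))"
        proof (cases "\<forall>i\<in>I. \<bar>\<xi> i w\<bar> \<le> R")
          case True
          then have "(\<Prod>i\<in>I. b) \<le> (\<Prod>i\<in>I. f (\<xi> i w))"
            using f_ge quarter by (intro prod_mono) auto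
          then show ?thesis using True \<open>w \<in> space M\<close> by simp
        next
          case False
          then show ?thesis using f01 by (auto intro!: prod_nonneg)
        qed
      qed
      finally show ?thesis .
    qed
    ultimately have "b ^ card I * prob {w \<in> space M. \<forall>i\<in>I. \<bar>\<xi> i w\<bar> \<le> R}
      \<le> b ^ card I * p ^ card I"
      by (simp add: power_mult_distrib mult.commute)
    then show "prob {w \<in> space M. \<forall>i\<in>I. \<bar>\<xi> i w\<bar> \<le> R} \<le> p ^ card I"
      using quarter by simp
  qed
qed

section \<open>Rectangular increments of the variance function and sums of powers\<close>

text \<open>The mean value theorem in the second variable, then in the first. The rectangle stays
  off the diagonal at distance at least \<open>t - s'\<close>, and the exponent is not positive, so
  the bound on the mixed derivative is worst at that distance.\<close>

lemma C1_mixed_bound_rectangle: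
  assumes f: "C1_mixed_bound T H c f" and "0 \<le> c" "H \<le> 1"
    and st: "0 \<le> s" "s < s'" "s' < t" "t < t'" "t' \<le> T"
  shows "\<bar>f s' t' - f s t' - (f s' t - f s t)\<bar>
    \<le> c * (s' - s) * (t' - t) * (t - s') powr (2 * H - 2)"
proof -
  obtain f1 f2 f12 where d: "\<And>x y. x \<in> {0..T} \<Longrightarrow> y \<in> {0..T} \<Longrightarrow> x \<noteq> y \<Longrightarrow>
      ((\<lambda>u. f u y) has_real_derivative f1 x y) (at x within {0..T}) \<and>
      ((\<lambda>u. f x u) has_real_derivative f2 x y) (at y within {0..T}) \<and>
      ((\<lambda>u. f2 u y) has_real_derivative f12 x y) (at x within {0..T}) \<and>
      \<bar>f12 x y\<bar> \<le> c * \<bar>y - x\<bar> powr (2 * H - 2)"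
    using f unfolding C1_mixed_bound_def by blast
  have "\<exists>y\<in>{t<..<t'}. (f s' t' - f s t') - (f s' t - f s t) = (f2 s' y - f2 s y) * (t' - t)"
  proof (rule mvt_simple)
    show "t < t'" by fact
    fix y assume y: "t \<le> y" "y \<le> t'"
    have "((\<lambda>u. f s' u - f s u) has_real_derivative f2 s' y - f2 s y) (at y within {0..T})"
      using d[of s' y] d[of s y] st y by (intro DERIV_diff) auto
    then have "((\<lambda>u. f s' u - f s u) has_real_derivative f2 s' y - f2 s y) (at y within {t..t'})"
      by (rule DERIV_subset) (use st in auto)
    then show "((\<lambda>u. f s' u - f s u) has_derivative (\<lambda>h. (f2 s' y - f2 s y) * h)) (at y within {t..t'})"
      by (simp add: has_field_derivative_def)
  qed
  then obtain y where y: "t < y" "y < t'"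
    "(f s' t' - f s t') - (f s' t - f s t) = (f2 s' y - f2 s y) * (t' - t)" by auto
  have "\<exists>x\<in>{s<..<s'}. f2 s' y - f2 s y = f12 x y * (s' - s)"
  proof (rule mvt_simple)
    show "s < s'" by fact
    fix x assume x: "s \<le> x" "x \<le> s'"
    have "((\<lambda>u. f2 u y) has_real_derivative f12 x y) (at x within {0..T})"
      using d[of x y] st y x by auto
    then have "((\<lambda>u. f2 u y) has_real_derivative f12 x y) (at x within {s..s'})"
      by (rule DERIV_subset) (use st in auto)
    then show "((\<lambda>u. f2 u y) has_derivative (\<lambda>h. f12 x y * h)) (at x within {s..s'})"
      by (simp add: has_field_derivative_def)
  qed
  then obtain x where x: "s < x" "x < s'" "f2 s' y - f2 s y = f12 x y * (s' - s)" by auto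
  have "\<bar>f12 x y\<bar> \<le> c * \<bar>y - x\<bar> powr (2 * H - 2)"
    using d[of x y] st x y by auto
  also have "\<dots> \<le> c * (t - s') powr (2 * H - 2)"
    using st x y assms(2,3) by (intro mult_left_mono powr_mono2') auto
  finally have "\<bar>f12 x y\<bar> * ((s' - s) * (t' - t)) \<le> c * (t - s') powr (2 * H - 2) * ((s' - s) * (t' - t))"
    using st by (intro mult_right_mono) auto
  moreover have "\<bar>f s' t' - f s t' - (f s' t - f s t)\<bar> = \<bar>f12 x y\<bar> * ((s' - s) * (t' - t))"
    using st by (simp add: y(3) x(3) abs_mult)
  ultimately show ?thesis by (simp add: mult_ac)
qed

lemma sum_abs_diff_powr_le:
  fixes r :: real
  assumes "r < - 1"
  obtains B where "0 < B" "\<And>n i. (\<Sum>j\<in>{..<n} - {i}. \<bar>real i - real j\<bar> powr r) \<le> B"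
proof -
  define g where "g k = real (Suc k) powr r" for k
  have "summable (\<lambda>k. real k powr r)"
    using assms by (simp add: summable_real_powr_iff)
  then have g: "summable g"
    unfolding g_def by (subst summable_Suc_iff)
  have "0 < suminf g" by (rule suminf_pos[OF g]) (simp add: g_def)
  moreover have "(\<Sum>j\<in>{..<n} - {i}. \<bar>real i - real j\<bar> powr r) \<le> 2 * suminf g" for n i
  proof -
    \<comment> \<open>The larger index set treats both sides of \<open>i\<close> as initial segments
      of one convergent series, whether or not \<open>i < n\<close>.\<close>
    have "(\<Sum>j\<in>{..<n} - {i}. \<bar>real i - real j\<bar> powr r)
        \<le> (\<Sum>j\<in>{..<i} \<union> {Suc i..<Suc i + n}. \<bar>real i - real j\<bar> powr r)"
      by (intro sum_mono2) auto
    also have "\<dots> = (\<Sum>j\<in>{..<i}. \<bar>real i - real j\<bar> powr r)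
        + (\<Sum>j\<in>{Suc i..<Suc i + n}. \<bar>real i - real j\<bar> powr r)"
      by (intro sum.union_disjoint) auto
    also have "(\<Sum>j\<in>{..<i}. \<bar>real i - real j\<bar> powr r) = sum g {..<i}"
      by (rule sum.reindex_bij_witness[where i = "\<lambda>k. i - Suc k" and j = "\<lambda>k. i - Suc k"])
        (auto simp: g_def of_nat_diff)
    also have "(\<Sum>j\<in>{Suc i..<Suc i + n}. \<bar>real i - real j\<bar> powr r) = sum g {..<n}"
      by (rule sum.reindex_bij_witness[where i = "\<lambda>k. Suc i + k" and j = "\<lambda>k. k - Suc i"])
        (auto simp: g_def of_nat_diff)
    also have "sum g {..<i} + sum g {..<n} \<le> suminf g + suminf g"
      by (intro add_mono sum_le_suminf[OF g]) (auto simp: g_def)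
    finally show ?thesis by simp
  qed
  ultimately show thesis by (intro that[of "2 * suminf g"]) auto
qed

section \<open>Increments of a Gaussian process and their covariances\<close>

lemma integrable_mult_square_integrable:
  fixes f g :: "'a \<Rightarrow> real"
  assumes "f \<in> borel_measurable M" "g \<in> borel_measurable M"
    and "integrable M (\<lambda>x. (f x)\<^sup>2)" "integrable M (\<lambda>x. (g x)\<^sup>2)"
  shows "integrable M (\<lambda>x. f x * g x)"
proof (rule Bochner_Integration.integrable_bound)
  show "integrable M (\<lambda>x. (f x)\<^sup>2 + (g x)\<^sup>2)" "(\<lambda>x. f x * g x) \<in> borel_measurable M"
    using assms by simp_all
  have "\<bar>a * b\<bar> \<le> a\<^sup>2 + b\<^sup>2" for a b :: real
    using sum_squares_bound[of "\<bar>a\<bar>" "\<bar>b\<bar>", unfolded power2_abs mult.assoc]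
      abs_ge_zero[of "a * b"] by (simp only: abs_mult)
  then show "AE x in M. norm (f x * g x) \<le> norm ((f x)\<^sup>2 + (g x)\<^sup>2)"
    by simp
qed

context prob_space
begin

lemma gaussian_process_increments:
  fixes s t :: "'i \<Rightarrow> real"
  assumes X: "centered_gaussian_process M D X" and I: "finite I"
    and D: "\<And>i. i \<in> I \<Longrightarrow> s i \<in> D" "\<And>i. i \<in> I \<Longrightarrow> t i \<in> D"
  shows "gaussian_rv M (\<lambda>w. \<Sum>i\<in>I. c i * (X (t i) w - X (s i) w))"
proof -
  \<comment> \<open>End points of different increments may coincide, so \<open>b u\<close> collects
    all occurrences of the time \<open>u\<close>.\<close>
  define b where "b u = (\<Sum>i\<in>I. c i * (of_bool (t i = u) - of_bool (s i = u)))" for u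
  have "(\<Sum>u\<in>s ` I \<union> t ` I. b u * X u w) = (\<Sum>i\<in>I. c i * (X (t i) w - X (s i) w))" for w
  proof -
    have "(\<Sum>u\<in>s ` I \<union> t ` I. b u * X u w) =
        (\<Sum>i\<in>I. \<Sum>u\<in>s ` I \<union> t ` I. (if t i = u then c i * X u w else 0) - (if s i = u then c i * X u w else 0))"
      unfolding b_def sum_distrib_right
      by (subst sum.swap) (intro sum.cong refl, auto)
    also have "\<dots> = (\<Sum>i\<in>I. c i * (X (t i) w - X (s i) w))"
      using I by (intro sum.cong refl) (simp add: sum_subtractf right_diff_distrib)
    finally show ?thesis .
  qed
  moreover have "gaussian_rv M (\<lambda>w. \<Sum>u\<in>s ` I \<union> t ` I. b u * X u w)"
    using X I D unfolding centered_gaussian_process_def by (auto simp: image_subset_iff)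
  ultimately show ?thesis by simp
qed

lemma gaussian_process_L2:
  assumes X: "centered_gaussian_process M D X" and t: "t \<in> D"
  shows "X t \<in> borel_measurable M" "integrable M (X t)" "expectation (X t) = 0"
    "integrable M (\<lambda>w. (X t w)\<^sup>2)"
proof -
  have F: "finite F \<and> F \<subseteq> D \<longrightarrow> gaussian_rv M (\<lambda>w. \<Sum>t\<in>F. b t * X t w)" for F b
    using X unfolding centered_gaussian_process_def by blast
  have "gaussian_rv M (X t)"
    using F[of "{t}" "\<lambda>_. 1"] t by simp
  moreover show "X t \<in> borel_measurable M" and 0: "expectation (X t) = 0"
    using X t unfolding centered_gaussian_process_def by auto
  ultimately show "integrable M (X t)" "integrable M (\<lambda>w. (X t w)\<^sup>2)"
    using centered_gaussian_rv by blast+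
qed

text \<open>A linear combination of increments is a centered Gaussian variable whose variance is the
  quadratic form of the covariances. This supplies the hypothesis on characteristic functions in
  \<open>gaussian_vector_small_ball\<close>.\<close>

lemma gaussian_process_increments_iexp:
  fixes s t :: "'i \<Rightarrow> real"
  assumes X: "centered_gaussian_process M D X" and I: "finite I"
    and D: "\<And>i. i \<in> I \<Longrightarrow> s i \<in> D" "\<And>i. i \<in> I \<Longrightarrow> t i \<in> D"
  defines "\<xi> \<equiv> \<lambda>i w. X (t i) w - X (s i) w"
  shows "(CLINT w|M. iexp (\<Sum>i\<in>I. c i * \<xi> i w))
    = exp (- of_real ((\<Sum>i\<in>I. \<Sum>j\<in>I. c i * c j * expectation (\<lambda>w. \<xi> i w * \<xi> j w)) / 2))"
proof -
  note L2 = gaussian_process_L2[OF X]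
  have meas: "\<xi> i \<in> borel_measurable M" if "i \<in> I" for i
    using L2(1)[OF D(1)[OF that]] L2(1)[OF D(2)[OF that]] unfolding \<xi>_def by measurable
  have int: "integrable M (\<xi> i)" "expectation (\<xi> i) = 0" if "i \<in> I" for i
    using L2(2,3)[OF D(1)[OF that]] L2(2,3)[OF D(2)[OF that]] by (simp_all add: \<xi>_def)
  have int2: "integrable M (\<lambda>w. (\<xi> i w)\<^sup>2)" if "i \<in> I" for i
    using centered_gaussian_rv(2)[of "\<xi> i"] gaussian_process_increments[OF X, of "{i}" s t "\<lambda>_. 1"]
      int[OF that] D[OF that] by (simp add: \<xi>_def)
  have prod: "integrable M (\<lambda>w. \<xi> i w * \<xi> j w)" if "i \<in> I" "j \<in> I" for i j
    using that by (intro integrable_mult_square_integrable meas int2)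
  have mean: "expectation (\<lambda>w. \<Sum>i\<in>I. c i * \<xi> i w) = 0"
    using int by (subst Bochner_Integration.integral_sum) simp_all
  have gauss: "gaussian_rv M (\<lambda>w. \<Sum>i\<in>I. c i * \<xi> i w)"
    unfolding \<xi>_def by (rule gaussian_process_increments[OF X I D])
  have square: "expectation (\<lambda>w. (\<Sum>i\<in>I. c i * \<xi> i w)\<^sup>2)
      = (\<Sum>i\<in>I. \<Sum>j\<in>I. c i * c j * expectation (\<lambda>w. \<xi> i w * \<xi> j w))"
  proof -
    have "(\<Sum>i\<in>I. c i * \<xi> i w)\<^sup>2 = (\<Sum>i\<in>I. \<Sum>j\<in>I. c i * c j * (\<xi> i w * \<xi> j w))" for w
      unfolding power2_eq_square sum_product by (simp add: mult_ac)
    then show ?thesis using prod by simp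
  qed
  show ?thesis using centered_gaussian_rv(3)[OF gauss mean] unfolding square .
qed

text \<open>Polarisation: in the rectangular difference the second moments of single values cancel.
  Covariances of increments thus come under the bound on the mixed derivative.\<close>

lemma expectation_increments_product:
  assumes X: "centered_gaussian_process M D X" and D: "s \<in> D" "s' \<in> D" "t \<in> D" "t' \<in> D"
  shows "2 * expectation (\<lambda>w. (X s' w - X s w) * (X t' w - X t w))
    = - (incr_var M X s' t' - incr_var M X s t' - (incr_var M X s' t - incr_var M X s t))"
proof -
  note L2 = gaussian_process_L2[OF X]
  have prod: "integrable M (\<lambda>w. X u w * X v w)" if "u \<in> D" "v \<in> D" for u v
    using that by (intro integrable_mult_square_integrable L2)
  have var: "incr_var M X u v = expectation (\<lambda>w. X v w * X v w) - 2 * expectation (\<lambda>w. X u w * X v w)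
      + expectation (\<lambda>w. X u w * X u w)" if "u \<in> D" "v \<in> D" for u v
  proof -
    have "(X v w - X u w)\<^sup>2 = X v w * X v w - 2 * (X u w * X v w) + X u w * X u w" for w
      by (simp add: power2_eq_square algebra_simps)
    then show ?thesis
      using prod[OF that] prod[OF that(1,1)] prod[OF that(2,2)] by (simp add: incr_var_def)
  qed
  have "(X s' w - X s w) * (X t' w - X t w) = X s' w * X t' w - X s w * X t' w - X s' w * X t w + X s w * X t w" for w
    by (simp add: algebra_simps)
  then have "expectation (\<lambda>w. (X s' w - X s w) * (X t' w - X t w))
      = expectation (\<lambda>w. X s' w * X t' w) - expectation (\<lambda>w. X s w * X t' w)
        - expectation (\<lambda>w. X s' w * X t w) + expectation (\<lambda>w. X s w * X t w)"
    using D prod by simp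
  then show ?thesis
    unfolding var[OF D(2) D(4)] var[OF D(1) D(4)] var[OF D(2) D(3)] var[OF D(1) D(3)] by simp
qed

end

text \<open>Increments of length \<open>\<delta>\<close> on a grid of step \<open>\<tau>\<close>
  have covariances controlled by rectangles of side \<open>\<delta>\<close>, and \<open>B\<close>
  sums their decay along a row. The two terms in front are the margin of dominance, into which the
  choice of \<open>\<tau>\<close> enters later.\<close>

lemma (in prob_space) class_X_increments_dominance:
  fixes \<delta> \<tau> :: real
  assumes X: "class_X H \<beta> c1 c2 C M T X" and H: "H < 1" and c1: "0 \<le> c1"
    and \<delta>: "0 < \<delta>" "2 * \<delta> \<le> \<tau>" and n: "real n * \<tau> \<le> T" and i: "i < n"
    and B: "(\<Sum>j\<in>{..<n} - {i}. \<bar>real i - real j\<bar> powr (2 * H - 2)) \<le> B"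
  defines "\<xi> \<equiv> \<lambda>i w. X (real i * \<tau> + \<delta>) w - X (real i * \<tau>) w"
  shows "c2 * \<delta> powr (2 * \<beta>) - c1 / 2 * \<delta>\<^sup>2 * (\<tau> / 2) powr (2 * H - 2) * B
      + (\<Sum>j\<in>{..<n} - {i}. \<bar>expectation (\<lambda>w. \<xi> i w * \<xi> j w)\<bar>)
    \<le> expectation (\<lambda>w. \<xi> i w * \<xi> i w)"
proof -
  have gauss: "centered_gaussian_process M {0..T} X" and mixed: "C1_mixed_bound T H c1 (incr_var M X)"
    and lower: "\<And>s t. s \<in> {0..T} \<Longrightarrow> t \<in> {0..T} \<Longrightarrow> c2 * \<bar>t - s\<bar> powr (2 * \<beta>) \<le> incr_var M X s t"
    using X by (auto simp: class_X_def)
  have \<tau>: "\<tau> > 0" using \<delta> by simp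
  have grid: "0 \<le> real j * \<tau>" "real j * \<tau> + \<delta> \<le> T" "real j * \<tau> \<le> T" if "j < n" for j
  proof -
    show "0 \<le> real j * \<tau>" using \<tau> by simp
    have "(real j + 1) * \<tau> \<le> real n * \<tau>"
      using that \<tau> by (intro mult_right_mono) auto
    then show "real j * \<tau> + \<delta> \<le> T" "real j * \<tau> \<le> T"
      using n \<delta> by (simp_all add: distrib_right)
  qed
  have cov: "\<bar>expectation (\<lambda>w. \<xi> j w * \<xi> k w)\<bar>
      \<le> c1 / 2 * \<delta>\<^sup>2 * (\<tau> / 2) powr (2 * H - 2) * (real k - real j) powr (2 * H - 2)"
    if "j < k" "k < n" for j k
  proof -
    have "1 * \<tau> \<le> (real k - real j) * \<tau>"
      using that \<tau> by (intro mult_right_mono) auto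
    moreover have "(real k - real j) * \<tau> = real k * \<tau> - real j * \<tau>"
      "(real k - real j) * (\<tau> / 2) = (real k * \<tau> - real j * \<tau>) / 2"
      by (simp_all add: left_diff_distrib diff_divide_distrib)
    \<comment> \<open>Since \<open>\<delta> \<le> \<tau> / 2\<close>, removing
      \<open>\<delta>\<close> leaves at least half of the distance between the grid points.\<close>
    ultimately have gap: "(real k - real j) * (\<tau> / 2) \<le> real k * \<tau> - (real j * \<tau> + \<delta>)"
      "0 < (real k - real j) * (\<tau> / 2)"
      using \<delta> \<tau> by linarith+
    have "2 * expectation (\<lambda>w. \<xi> j w * \<xi> k w)
      = - (incr_var M X (real j * \<tau> + \<delta>) (real k * \<tau> + \<delta>) - incr_var M X (real j * \<tau>) (real k * \<tau> + \<delta>)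
        - (incr_var M X (real j * \<tau> + \<delta>) (real k * \<tau>) - incr_var M X (real j * \<tau>) (real k * \<tau>)))"
      unfolding \<xi>_def using that grid[of j] grid[of k] \<delta> \<tau>
      by (intro expectation_increments_product[OF gauss]) auto
    moreover have "\<bar>incr_var M X (real j * \<tau> + \<delta>) (real k * \<tau> + \<delta>) - incr_var M X (real j * \<tau>) (real k * \<tau> + \<delta>)
        - (incr_var M X (real j * \<tau> + \<delta>) (real k * \<tau>) - incr_var M X (real j * \<tau>) (real k * \<tau>))\<bar>
      \<le> c1 * (real j * \<tau> + \<delta> - real j * \<tau>) * (real k * \<tau> + \<delta> - real k * \<tau>)
        * (real k * \<tau> - (real j * \<tau> + \<delta>)) powr (2 * H - 2)"
      using that grid[of j] grid[of k] \<delta> gap H c1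
      by (intro C1_mixed_bound_rectangle[OF mixed]) linarith+
    ultimately have "2 * \<bar>expectation (\<lambda>w. \<xi> j w * \<xi> k w)\<bar>
      \<le> c1 * (real j * \<tau> + \<delta> - real j * \<tau>) * (real k * \<tau> + \<delta> - real k * \<tau>)
        * (real k * \<tau> - (real j * \<tau> + \<delta>)) powr (2 * H - 2)"
      by linarith
    also have "\<dots> = c1 * \<delta>\<^sup>2 * (real k * \<tau> - (real j * \<tau> + \<delta>)) powr (2 * H - 2)"
      by (simp add: power2_eq_square)
    also have "\<dots> \<le> c1 * \<delta>\<^sup>2 * ((real k - real j) * (\<tau> / 2)) powr (2 * H - 2)"
      using gap H c1 by (intro mult_left_mono powr_mono2') auto
    also have "((real k - real j) * (\<tau> / 2)) powr (2 * H - 2)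
        = (real k - real j) powr (2 * H - 2) * (\<tau> / 2) powr (2 * H - 2)"
      by (rule powr_mult)
    finally show ?thesis by (simp add: mult_ac)
  qed
  have "(\<Sum>j\<in>{..<n} - {i}. \<bar>expectation (\<lambda>w. \<xi> i w * \<xi> j w)\<bar>)
      \<le> (\<Sum>j\<in>{..<n} - {i}. c1 / 2 * \<delta>\<^sup>2 * (\<tau> / 2) powr (2 * H - 2) * \<bar>real i - real j\<bar> powr (2 * H - 2))"
  proof (rule sum_mono)
    fix j assume "j \<in> {..<n} - {i}"
    then consider "i < j" "j < n" | "j < i" by fastforce
    then show "\<bar>expectation (\<lambda>w. \<xi> i w * \<xi> j w)\<bar>
        \<le> c1 / 2 * \<delta>\<^sup>2 * (\<tau> / 2) powr (2 * H - 2) * \<bar>real i - real j\<bar> powr (2 * H - 2)"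
    proof cases
      case 1
      then show ?thesis using cov[of i j] by (simp add: abs_if)
    next
      case 2
      then show ?thesis using cov[of j i] i by (simp add: abs_if mult.commute[of "\<xi> j _"])
    qed
  qed
  also have "\<dots> = c1 / 2 * \<delta>\<^sup>2 * (\<tau> / 2) powr (2 * H - 2)
      * (\<Sum>j\<in>{..<n} - {i}. \<bar>real i - real j\<bar> powr (2 * H - 2))"
    by (simp only: sum_distrib_left)
  also have "\<dots> \<le> c1 / 2 * \<delta>\<^sup>2 * (\<tau> / 2) powr (2 * H - 2) * B"
    using c1 B by (intro mult_left_mono) auto
  moreover have "c2 * \<delta> powr (2 * \<beta>) \<le> expectation (\<lambda>w. \<xi> i w * \<xi> i w)"
    using lower[of "real i * \<tau>" "real i * \<tau> + \<delta>"] grid[OF i] \<delta>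
    by (simp add: incr_var_def \<xi>_def power2_eq_square)
  ultimately show ?thesis by linarith
qed

section \<open>Pathwise control of the drift, and events that need not be measurable\<close>

text \<open>The integral of \<open>a\<close> is Lipschitz with constant \<open>K\<close>. The
  argument fixes \<open>w\<close>, so any dependence between \<open>a\<close> and \<open>X\<close>
  is harmless.\<close>

lemma with_drift_increment:
  assumes a: "set_integrable lebesgue {0..T} (\<lambda>s. a s w)"
    and K: "\<And>t. t \<in> {0..T} \<Longrightarrow> \<bar>a t w\<bar> \<le> K"
    and st: "0 \<le> s" "s \<le> t" "t \<le> T"
    and y: "\<bar>with_drift X a s w\<bar> \<le> \<epsilon>" "\<bar>with_drift X a t w\<bar> \<le> \<epsilon>"
  shows "\<bar>X t w - X s w\<bar> \<le> 2 * \<epsilon> + K * (t - s)"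
proof -
  have int: "set_integrable lebesgue A (\<lambda>s. a s w)" if "A \<in> sets lebesgue" "A \<subseteq> {0..T}" for A
    using set_integrable_subset[OF a that] .
  have "(LINT u:{0..t}|lebesgue. a u w) = (LINT u:{0..s} \<union> {s<..t}|lebesgue. a u w)"
    using st by (simp add: ivl_disj_un)
  also have "\<dots> = (LINT u:{0..s}|lebesgue. a u w) + (LINT u:{s<..t}|lebesgue. a u w)"
    using st by (intro set_integral_Un int) auto
  finally have split: "(LINT u:{0..t}|lebesgue. a u w)
    = (LINT u:{0..s}|lebesgue. a u w) + (LINT u:{s<..t}|lebesgue. a u w)" .
  have "norm (LINT u:{s<..t}|lebesgue. a u w) \<le> (LINT u:{s<..t}|lebesgue. norm (a u w))"
    using st by (intro set_integral_norm_bound int) auto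
  also have "\<dots> \<le> (LINT u:{s<..t}|lebesgue. K)"
  proof (rule set_integral_mono)
    show "set_integrable lebesgue {s<..t} (\<lambda>u. norm (a u w))"
      using st by (intro set_integrable_norm int) auto
    show "set_integrable lebesgue {s<..t} (\<lambda>u. K)"
      using st by (simp add: set_integrable_def)
    show "norm (a u w) \<le> K" if "u \<in> {s<..t}" for u
      using K[of u] that st by simp
  qed
  also have "\<dots> = K * (t - s)"
    using st by (simp add: set_lebesgue_integral_def)
  finally have "\<bar>LINT u:{s<..t}|lebesgue. a u w\<bar> \<le> K * (t - s)" by simp
  then show ?thesis
    using y split unfolding with_drift_def by linarith
qed

text \<open>The set \<open>A\<close> may fail to be measurable, but it is covered by
  \<open>E\<close> and a measurable null set.\<close>

lemma outer_prob_le_AE: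
  assumes E: "E \<in> sets M" and AE: "AE w in M. w \<in> A \<longrightarrow> w \<in> E" and A: "A \<subseteq> space M"
  shows "outer_prob M A \<le> emeasure M E"
proof -
  obtain N where N: "{w \<in> space M. \<not> (w \<in> A \<longrightarrow> w \<in> E)} \<subseteq> N" "emeasure M N = 0" "N \<in> sets M"
    using AE by (rule AE_E)
  have "outer_prob M A \<le> outer_measure_of M (E \<union> N)"
    unfolding outer_prob_def using A N(1) by (intro outer_measure_of_mono) auto
  also have "\<dots> = emeasure M (E \<union> N)" using E N by simp
  also have "\<dots> \<le> emeasure M E + emeasure M N" using E N by (intro emeasure_subadditive)
  finally show ?thesis using N by simp
qed

section \<open>Choice of the constants and the final estimate\<close>

theorem corollary3p2:
  fixes H \<beta> c1 c2 C K :: real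
  assumes "0 < H" and "H < 1/2" and "H \<le> \<beta>" and "\<beta> < 1"
    and "0 < c1" and "0 < c2" and "0 < C"
  shows "\<exists>C1>0. \<exists>C2>0.
    \<forall>(M :: 'w measure) (T :: real) (X :: real \<Rightarrow> 'w \<Rightarrow> real) (a :: real \<Rightarrow> 'w \<Rightarrow> real) (\<epsilon> :: real).
      prob_space M \<longrightarrow> 0 < T \<longrightarrow>
      class_X H \<beta> c1 c2 C M T X \<longrightarrow>
      drift_process M T a \<longrightarrow> as_bounded_by M T K a \<longrightarrow>
      0 < \<epsilon> \<longrightarrow> \<epsilon> < 1 \<longrightarrow>
      outer_prob M {w \<in> space M. sup_norm T (\<lambda>t. with_drift X a t w) \<le> ereal \<epsilon>}
        \<le> ennreal (C1 * exp (- C2 * T * \<epsilon> powr (- ((2 * H - 2 * \<beta> + 1) / \<beta>))))"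
proof -
  define r where "r = 2 * H - 2"
  have "r < - 1" using assms by (simp add: r_def)
  then obtain B where B: "0 < B" "\<And>n i. (\<Sum>j\<in>{..<n} - {i}. \<bar>real i - real j\<bar> powr r) \<le> B"
    by (rule sum_abs_diff_powr_le) blast
  \<comment> \<open>The second argument solves \<open>c1 / 2 * m powr r * B = c2 / 2\<close>; since
    \<open>r < 0\<close>, enlarging \<open>m\<close> keeps the inequality. The bound
    \<open>1 \<le> m\<close> later gives \<open>2 * \<delta> \<le> \<tau>\<close>.\<close>
  define m where "m = max 1 ((c2 / (c1 * B)) powr (1 / r))"
  have m: "1 \<le> m" "c1 / 2 * m powr r * B \<le> c2 / 2"
  proof -
    show "1 \<le> m" by (simp add: m_def)
    have "m powr r \<le> ((c2 / (c1 * B)) powr (1 / r)) powr r"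
      using assms B \<open>r < -1\<close> by (intro powr_mono2') (auto simp: m_def)
    also have "\<dots> = c2 / (c1 * B)"
      using assms B \<open>r < -1\<close> by (simp add: powr_powr)
    finally show "c1 / 2 * m powr r * B \<le> c2 / 2"
      using assms B by (simp add: field_simps)
  qed
  define \<rho> where "\<rho> = 1 - 2 * (\<beta> - H)"
  \<comment> \<open>With \<open>R = (2 + \<bar>K\<bar>) * \<epsilon>\<close> this makes
    \<open>(\<alpha> * R)\<^sup>2\<close> half of the lower bound
    \<open>c2 * \<epsilon>\<^sup>2\<close> for the variances. It involves neither \<open>T\<close>
    nor \<open>\<epsilon>\<close>, and so neither does \<open>p\<close>.\<close>
  define \<alpha> where "\<alpha> = sqrt (c2 / 2) / (2 + \<bar>K\<bar>)"
  have "0 < \<alpha>" using assms by (simp add: \<alpha>_def add_pos_nonneg)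
  then obtain p where p: "0 < p" "p < 1" and small_ball:
    "\<And>(M :: 'w measure) (I :: nat set) \<xi> \<Sigma> R.
      prob_space M \<Longrightarrow> finite I \<Longrightarrow> 0 < R \<Longrightarrow>
      (\<And>i. i \<in> I \<Longrightarrow> \<xi> i \<in> borel_measurable M) \<Longrightarrow>
      (\<And>c. (CLINT w|M. iexp (\<Sum>i\<in>I. c i * \<xi> i w))
        = exp (- of_real ((\<Sum>i\<in>I. \<Sum>j\<in>I. c i * c j * \<Sigma> i j) / 2))) \<Longrightarrow>
      (\<And>i j. i \<in> I \<Longrightarrow> j \<in> I \<Longrightarrow> \<Sigma> i j = \<Sigma> j i) \<Longrightarrow>
      (\<And>i. i \<in> I \<Longrightarrow> (\<alpha> * R)\<^sup>2 + (\<Sum>j\<in>I - {i}. \<bar>\<Sigma> i j\<bar>) \<le> \<Sigma> i i) \<Longrightarrow>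
      measure M {w \<in> space M. \<forall>i\<in>I. \<bar>\<xi> i w\<bar> \<le> R} \<le> p ^ card I"
    by (rule gaussian_vector_small_ball) blast
  \<comment> \<open>The rate \<open>- ln p / (2 * m)\<close> comes from
    \<open>p powr (T / \<tau>)\<close>, and \<open>1 / p\<close> pays for rounding
    \<open>T / \<tau>\<close> down.\<close>
  have bound: "outer_prob M {w \<in> space M. sup_norm T (\<lambda>t. with_drift X a t w) \<le> ereal \<epsilon>}
      \<le> ennreal (1 / p * exp (- (- ln p / (2 * m)) * T * \<epsilon> powr (- ((2 * H - 2 * \<beta> + 1) / \<beta>))))"
    if "prob_space M" and T: "0 < T" and X: "class_X H \<beta> c1 c2 C M T X"
      and a: "drift_process M T a" "as_bounded_by M T K a" and \<epsilon>: "0 < \<epsilon>" "\<epsilon> < 1"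
    for M :: "'w measure" and T X a \<epsilon>
  proof -
    interpret prob_space M by fact
    define \<delta> where "\<delta> = \<epsilon> powr (1 / \<beta>)"
    define \<tau> where "\<tau> = 2 * m * \<delta> powr \<rho>"
    define n where "n = nat \<lfloor>T / \<tau>\<rfloor>"
    define \<xi> where "\<xi> i w = X (real i * \<tau> + \<delta>) w - X (real i * \<tau>) w" for i w
    define \<Sigma> where "\<Sigma> i j = expectation (\<lambda>w. \<xi> i w * \<xi> j w)" for i j
    define R where "R = (2 + \<bar>K\<bar>) * \<epsilon>"
    have \<beta>: "0 < \<beta>" using assms by simp
    have \<delta>: "0 < \<delta>" "\<delta> \<le> 1" "\<delta> \<le> \<epsilon>" "\<delta> powr \<beta> = \<epsilon>"
    proof -
      show "0 < \<delta>" using \<epsilon> by (simp add: \<delta>_def)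
      have "\<epsilon> powr (1 / \<beta>) \<le> \<epsilon> powr 1"
        using \<epsilon> \<beta> assms by (intro powr_mono') auto
      then show "\<delta> \<le> \<epsilon>" using \<epsilon> by (simp add: \<delta>_def)
      then show "\<delta> \<le> 1" using \<epsilon> by simp
      show "\<delta> powr \<beta> = \<epsilon>" using \<epsilon> \<beta> by (simp add: \<delta>_def powr_powr)
    qed
    \<comment> \<open>Here \<open>H \<le> \<beta>\<close> enters as
      \<open>\<rho> \<le> 1\<close>.\<close>
    have "\<delta> powr 1 \<le> \<delta> powr \<rho>"
      using \<delta> assms by (intro powr_mono') (auto simp: \<rho>_def)
    then have "1 * \<delta> \<le> m * \<delta> powr \<rho>"
      using \<delta> m by (intro mult_mono) auto
    then have \<tau>: "2 * \<delta> \<le> \<tau>" "0 < \<tau>" using \<delta> by (simp_all add: \<tau>_def)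
    have n: "real n * \<tau> \<le> T" "T / \<tau> - 1 \<le> real n"
    proof -
      have "real n \<le> T / \<tau>" using T \<tau> by (simp add: n_def)
      then show "real n * \<tau> \<le> T" using \<tau> by (simp add: field_simps)
      show "T / \<tau> - 1 \<le> real n" unfolding n_def by linarith
    qed
    have grid: "real i * \<tau> \<in> {0..T}" "real i * \<tau> + \<delta> \<in> {0..T}" if "i < n" for i
    proof -
      have "(real i + 1) * \<tau> \<le> real n * \<tau>"
        using that \<tau> by (intro mult_right_mono) auto
      then show "real i * \<tau> \<in> {0..T}" "real i * \<tau> + \<delta> \<in> {0..T}"
        using n \<delta> \<tau> by (simp_all add: distrib_right)
    qed
    have gauss: "centered_gaussian_process M {0..T} X"
      using X by (simp add: class_X_def)
    have [measurable]: "\<xi> i \<in> borel_measurable M" if "i < n" for i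
      using gaussian_process_L2(1)[OF gauss grid(1)[OF that]]
        gaussian_process_L2(1)[OF gauss grid(2)[OF that]]
      unfolding \<xi>_def by measurable
    have "R > 0" using \<epsilon> by (simp add: R_def add_pos_nonneg)
    have \<alpha>R: "(\<alpha> * R)\<^sup>2 = c2 / 2 * \<delta> powr (2 * \<beta>)"
    proof -
      have "\<alpha> * R = sqrt (c2 / 2) * \<epsilon>"
        by (simp add: \<alpha>_def R_def)
      moreover have "\<epsilon>\<^sup>2 = \<delta> powr (2 * \<beta>)"
        by (simp add: power2_eq_square flip: \<delta>(4) powr_add)
      ultimately show ?thesis using assms by (simp add: power_mult_distrib)
    qed
    \<comment> \<open>The power of \<open>\<delta>\<close> on the left is
      \<open>2 + \<rho> * r\<close>. It is at least \<open>2 * \<beta>\<close> because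
      \<open>H \<le> \<beta>\<close> and \<open>2 - 2 * H \<ge> 1\<close>, and
      \<open>\<delta> \<le> 1\<close>; the choice of \<open>m\<close> handles the constant.\<close>
    have off: "c1 / 2 * \<delta>\<^sup>2 * (\<tau> / 2) powr r * B \<le> c2 / 2 * \<delta> powr (2 * \<beta>)"
    proof -
      have "\<delta>\<^sup>2 * (\<tau> / 2) powr r = m powr r * (\<delta>\<^sup>2 * \<delta> powr (\<rho> * r))"
        using m by (simp add: \<tau>_def powr_mult powr_powr)
      also have "\<delta>\<^sup>2 * \<delta> powr (\<rho> * r) = \<delta> powr (2 + \<rho> * r)"
        using \<delta> by (simp add: powr_add)
      also have "2 + \<rho> * r = 2 * H + 2 * ((\<beta> - H) * (2 - 2 * H))"
        by (simp add: \<rho>_def r_def algebra_simps)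
      also have "\<delta> powr (2 * H + 2 * ((\<beta> - H) * (2 - 2 * H))) \<le> \<delta> powr (2 * \<beta>)"
      proof (rule powr_mono')
        have "(\<beta> - H) * 1 \<le> (\<beta> - H) * (2 - 2 * H)"
          using assms by (intro mult_left_mono) auto
        then show "2 * \<beta> \<le> 2 * H + 2 * ((\<beta> - H) * (2 - 2 * H))" by simp
      qed (use \<delta> in auto)
      finally have "\<delta>\<^sup>2 * (\<tau> / 2) powr r \<le> m powr r * \<delta> powr (2 * \<beta>)"
        by (simp add: mult_left_mono)
      then have "(c1 / 2 * B) * (\<delta>\<^sup>2 * (\<tau> / 2) powr r) \<le> (c1 / 2 * B) * (m powr r * \<delta> powr (2 * \<beta>))"
        using assms B by (intro mult_left_mono) auto
      also have "\<dots> = (c1 / 2 * m powr r * B) * \<delta> powr (2 * \<beta>)"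
        by (simp add: mult_ac)
      also have "\<dots> \<le> c2 / 2 * \<delta> powr (2 * \<beta>)"
        using m by (intro mult_right_mono) auto
      finally show ?thesis by (simp add: mult_ac)
    qed
    define E where "E = {w \<in> space M. \<forall>i\<in>{..<n}. \<bar>\<xi> i w\<bar> \<le> R}"
    have "E \<in> sets M" unfolding E_def by measurable
    have "prob E \<le> p ^ card {..<n}"
      unfolding E_def
    proof (rule small_ball[where \<Sigma> = \<Sigma>])
      show "(CLINT w|M. iexp (\<Sum>i\<in>{..<n}. c i * \<xi> i w))
        = exp (- of_real ((\<Sum>i\<in>{..<n}. \<Sum>j\<in>{..<n}. c i * c j * \<Sigma> i j) / 2))" for c
        unfolding \<xi>_def \<Sigma>_def using grid
        by (intro gaussian_process_increments_iexp[OF gauss]) auto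
      show "\<Sigma> i j = \<Sigma> j i" for i j
        by (simp add: \<Sigma>_def mult.commute)
      \<comment> \<open>One half of the lower bound for the variance absorbs the covariances, by
        \<open>off\<close>; the other half is the left summand.\<close>
      show "(\<alpha> * R)\<^sup>2 + (\<Sum>j\<in>{..<n} - {i}. \<bar>\<Sigma> i j\<bar>) \<le> \<Sigma> i i" if "i \<in> {..<n}" for i
        using class_X_increments_dominance[OF X _ _ \<delta>(1) \<tau>(1) n(1), of i B] that off \<alpha>R B(2)[of i n] assms
        by (simp add: \<Sigma>_def \<xi>_def r_def)
    qed (use \<open>prob_space M\<close> \<open>R > 0\<close> in auto)
    have "AE w in M. w \<in> {w \<in> space M. sup_norm T (\<lambda>t. with_drift X a t w) \<le> ereal \<epsilon>} \<longrightarrow> w \<in> E"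
      using a(1)[unfolded drift_process_def, THEN conjunct2] a(2)[unfolded as_bounded_by_def]
    proof eventually_elim
      fix w
      assume int: "set_integrable lebesgue {0..T} (\<lambda>s. a s w)" and K: "\<forall>t\<in>{0..T}. \<bar>a t w\<bar> \<le> K"
      show "w \<in> {w \<in> space M. sup_norm T (\<lambda>t. with_drift X a t w) \<le> ereal \<epsilon>} \<longrightarrow> w \<in> E"
      proof
        assume w: "w \<in> {w \<in> space M. sup_norm T (\<lambda>t. with_drift X a t w) \<le> ereal \<epsilon>}"
        then have y: "\<bar>with_drift X a t w\<bar> \<le> \<epsilon>" if "t \<in> {0..T}" for t
          using that by (auto simp: sup_norm_def SUP_le_iff)
        have "\<bar>\<xi> i w\<bar> \<le> R" if "i < n" for i
        proof -
          have "\<bar>\<xi> i w\<bar> \<le> 2 * \<epsilon> + K * (real i * \<tau> + \<delta> - real i * \<tau>)"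
            unfolding \<xi>_def using grid[OF that] \<delta> y K
            by (intro with_drift_increment[where a = a and w = w, OF int]) auto
          also have "\<dots> \<le> 2 * \<epsilon> + \<bar>K\<bar> * \<epsilon>"
            using \<delta> by (auto intro!: mult_mono)
          finally show ?thesis by (simp add: R_def distrib_right)
        qed
        then show "w \<in> E" using w by (simp add: E_def)
      qed
    qed
    then have "outer_prob M {w \<in> space M. sup_norm T (\<lambda>t. with_drift X a t w) \<le> ereal \<epsilon>} \<le> emeasure M E"
      by (intro outer_prob_le_AE \<open>E \<in> sets M\<close>) auto
    also have "\<dots> = ennreal (prob E)" by (rule emeasure_eq_measure)
    also have "\<dots> \<le> ennreal (1 / p * exp (- (- ln p / (2 * m)) * T * \<epsilon> powr (- ((2 * H - 2 * \<beta> + 1) / \<beta>))))"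
    proof (rule ennreal_leI)
      have "\<rho> = 2 * H - 2 * \<beta> + 1" by (simp add: \<rho>_def)
      then have "\<delta> powr \<rho> = \<epsilon> powr ((2 * H - 2 * \<beta> + 1) / \<beta>)"
        by (simp add: \<delta>_def powr_powr)
      then have rate: "T / \<tau> = T / (2 * m) * \<epsilon> powr (- ((2 * H - 2 * \<beta> + 1) / \<beta>))"
        unfolding \<tau>_def powr_minus_divide by simp
      have "prob E \<le> p powr real n"
        using \<open>prob E \<le> p ^ card {..<n}\<close> p by (simp add: powr_realpow)
      \<comment> \<open>As \<open>p < 1\<close>, a smaller exponent gives a larger power. For
        \<open>T < \<tau>\<close> there are no increments, and the right-hand side is at least
        1.\<close>
      also have "\<dots> \<le> p powr (T / \<tau> - 1)"
        using p n by (intro powr_mono') auto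
      also have "\<dots> = 1 / p * exp (ln p * (T / \<tau>))"
        using p by (simp only: powr_diff) (simp add: powr_def mult.commute)
      also have "ln p * (T / \<tau>) = - (- ln p / (2 * m)) * T * \<epsilon> powr (- ((2 * H - 2 * \<beta> + 1) / \<beta>))"
        unfolding rate by simp
      finally show "prob E \<le> 1 / p * exp (- (- ln p / (2 * m)) * T * \<epsilon> powr (- ((2 * H - 2 * \<beta> + 1) / \<beta>)))" .
    qed
    finally show ?thesis .
  qed
  show ?thesis
  proof (intro exI conjI)
    show "0 < 1 / p" using p by simp
    show "0 < - ln p / (2 * m)" using p m by (simp add: divide_neg_pos)
  qed (use bound in blast)
qed

end
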